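(* Let $P$ be a right LCM semigroup satisfying the descending chain condition, let $P_0\subseteq P$ be a minimal set, and let $T:P\to\mathcal{B}(\mathcal{H})$ be a unital contractive representation on a Hilbert space $\mathcal{H}$. The following are equivalent: (1) $T$ has a $\ast$-regular dilation; (2) $T$ has a minimal isometric Nica-covariant dilation; (3) for every finite set $F\subset P_0$, $$Z(F)=\sum_{U\subseteq F}(-1)^{|U|}\,TT^*(\vee U)\ \ge\ 0.$$
   Context: A unital semigroup $P$ (identity $e$) is right LCM if it is left cancellative ($pa=pb\Rightarrow a=b$) and for all $p,q\in P$ either $pP\cap qP=\emptyset$ or $pP\cap qP=rP$ for some $r\in P$. $P^\ast$ is the set of invertible elements. $P$ satisfies the descending chain condition if there are no infinite sequences $x_n\in P$, $y_n\in P\setminus P^\ast$ such that for every $n$ either $x_n=x_{n+1}y_n$ or $x_n=y_nx_{n+1}$. An element $x\in P$ is minimal if $x\notin P^\ast$ and whenever $x=yz$ with $y,z\in P$, then $y\in P^\ast$ or $z\in P^\ast$; $P_{min}$ is the set of minimal elements. For finite $F\subset P$, $\vee F=\{r\in P:\bigcap_{x\in F}xP=rP\}$ (a possibly empty set; $\vee\emptyset=P^\ast$), and $p\vee q=\vee\{p,q\}$. If $s\in pP$, $p^{-1}s$ denotes the unique $t\in P$ with $pt=s$, and $p^{-1}(p\vee q)=\{p^{-1}s:s\in p\vee q\}$. A subset $P_0\subseteq P$ is a minimal set if $P_{min}\subseteq P_0$ and $x^{-1}(x\vee y)\subseteq P_0\cup P^\ast$ for all $x\in P_{min}$, $y\in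 P_0$. A unital contractive representation is a map $T:P\to\mathcal{B}(\mathcal{H})$ with $T(e)=I$, $T(pq)=T(p)T(q)$, $\|T(p)\|\le1$. Write $TT^*(p)=T(p)T(p)^*$. $TT^*(\vee U)=TT^*(r)$ for any $r\in\vee U$ (independent of $r$), and $TT^*(\vee U)=0$ if $\vee U$ is the empty set. The term $U=\emptyset$ of $Z(F)$ is $I$. $T$ has a $\ast$-regular dilation if the kernel $K(p,q)=T(p^{-1}s)T(q^{-1}s)^*$ for any $s\in p\vee q$ (independent of $s$), $K(p,q)=0$ if $p\vee q=\emptyset$, is completely positive definite, i.e. $[K(p_i,p_j)]_{i,j}\ge0$ for all $p_1,\dots,p_n\in P$. A minimal isometric Nica-covariant dilation of $T$ is a representation $V:P\to\mathcal{B}(\mathcal{K})$, $\mathcal{K}\supset\mathcal{H}$ a Hilbert space, such that every $V(p)$ is an isometry; $T(p)=P_{\mathcal{H}}V(p)|_{\mathcal{H}}$ for all $p$; $\mathcal{K}=\overline{\operatorname{span}}\{V(p)h:p\in P,h\in\mathcal{H}\}$; and for all $p,q$, $V(p)V(p)^*V(q)V(q)^*=V(r)V(r)^*$ if $pP\cap qP=rP$, and $=0$ if $pP\cap qP=\emptyset$. *)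

theory Defs
  imports
    "HOL-Analysis.Analysis"
    "HOL-Library.Nonpos_Ints"
    "HOL-Library.Function_Algebras"
begin

section \<open>Complex vector spaces and Hilbert spaces\<close>

class complex_vector = ab_group_add +
  fixes scaleC :: "complex \<Rightarrow> 'a \<Rightarrow> 'a"  (infixr \<open>*\<^sub>C\<close> 75)
  assumes scaleC_add_right: "c *\<^sub>C (x + y) = c *\<^sub>C x + c *\<^sub>C y"
    and scaleC_add_left: "(c + d) *\<^sub>C x = c *\<^sub>C x + d *\<^sub>C x"
    and scaleC_scaleC: "c *\<^sub>C d *\<^sub>C x = (c * d) *\<^sub>C x"
    and scaleC_one: "1 *\<^sub>C x = x"

global_interpretation complex_vector: vector_space "scaleC :: complex \<Rightarrow> 'a \<Rightarrow> 'a :: complex_vector"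
  defines csubspace = complex_vector.subspace
    and cspan = complex_vector.span
  by unfold_locales (simp_all add: scaleC_add_right scaleC_add_left scaleC_scaleC scaleC_one)

abbreviation clinear :: "('a::complex_vector \<Rightarrow> 'b::complex_vector) \<Rightarrow> bool"
  where "clinear \<equiv> Vector_Spaces.linear scaleC scaleC"

instantiation "fun" :: (type, complex_vector) complex_vector
begin

definition "c *\<^sub>C f = (\<lambda>x. c *\<^sub>C f x)"

instance
  by standard
    (simp_all add: scaleC_fun_def fun_eq_iff scaleC_add_right scaleC_add_left scaleC_scaleC scaleC_one)

end

text \<open>The complex inner product is linear in the first argument; its real part is the
  inner product of the underlying real space, so the norms and topologies agree.\<close>

class chilbert_space = real_inner + complete_space + complex_vector +
  fixes cinner :: "'a \<Rightarrow> 'a \<Rightarrow> complex"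
  assumes scaleR_scaleC: "r *\<^sub>R x = complex_of_real r *\<^sub>C x"
    and cinner_commute: "cinner x y = cnj (cinner y x)"
    and cinner_add_left: "cinner (x + y) z = cinner x z + cinner y z"
    and cinner_scaleC_left: "cinner (c *\<^sub>C x) y = c * cinner x y"
    and Re_cinner: "Re (cinner x y) = inner x y"

text \<open>Since HOL cannot quantify existentially over types, the dilation space is a complex
  subspace \<open>S\<close> of an ambient complex vector space with its own inner product \<open>ip\<close>,
  complete for the norm induced by \<open>ip\<close>. Values of \<open>ip\<close> outside \<open>S\<close> are irrelevant.\<close>

definition ipnorm :: "('k \<Rightarrow> 'k \<Rightarrow> complex) \<Rightarrow> 'k \<Rightarrow> real"
  where "ipnorm ip x = sqrt (Re (ip x x))"

locale hilbert_space_on =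
  fixes S :: "'k::complex_vector set" and ip :: "'k \<Rightarrow> 'k \<Rightarrow> complex"
  assumes subspace: "csubspace S"
    and ip_commute: "\<lbrakk>x \<in> S; y \<in> S\<rbrakk> \<Longrightarrow> ip x y = cnj (ip y x)"
    and ip_add_left: "\<lbrakk>x \<in> S; y \<in> S; z \<in> S\<rbrakk> \<Longrightarrow> ip (x + y) z = ip x z + ip y z"
    and ip_scaleC_left: "\<lbrakk>x \<in> S; y \<in> S\<rbrakk> \<Longrightarrow> ip (c *\<^sub>C x) y = c * ip x y"
    and ip_nonneg: "x \<in> S \<Longrightarrow> ip x x \<in> \<real>\<^sub>\<ge>\<^sub>0"
    and ip_definite: "\<lbrakk>x \<in> S; ip x x = 0\<rbrakk> \<Longrightarrow> x = 0"
    and ip_complete: "\<lbrakk>\<And>n. X n \<in> S; \<forall>e>0. \<exists>N. \<forall>m\<ge>N. \<forall>n\<ge>N. ipnorm ip (X m - X n) < e\<rbrakk>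
      \<Longrightarrow> \<exists>x\<in>S. (\<lambda>n. ipnorm ip (X n - x)) \<longlonglongrightarrow> 0"

lemma hilbert_space_on_UNIV: "hilbert_space_on (UNIV :: 'h::chilbert_space set) cinner"
proof
  have ipnorm: "ipnorm cinner x = norm x" for x :: 'h
    by (simp add: ipnorm_def Re_cinner norm_eq_sqrt_inner)
  have self: "cinner x x = complex_of_real (inner x x)" for x :: 'h
    using cinner_commute[of x x] Re_cinner[of x x]
    by (simp add: complex_eq_iff)
  show "csubspace (UNIV :: 'h set)"
    by (rule complex_vector.subspace_UNIV)
  show "cinner x x \<in> \<real>\<^sub>\<ge>\<^sub>0" for x :: 'h
    by (simp add: self)
  show "x = 0" if "cinner x x = 0" for x :: 'h
    using that by (simp add: self)
  show "\<exists>x\<in>UNIV. (\<lambda>n. ipnorm cinner (X n - x)) \<longlonglongrightarrow> 0"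
    if "\<forall>e>0. \<exists>N. \<forall>m\<ge>N. \<forall>n\<ge>N. ipnorm cinner (X m - X n) < e" for X :: "nat \<Rightarrow> 'h"
  proof -
    have "Cauchy X"
      using that by (auto simp: Cauchy_def dist_norm ipnorm)
    then obtain x where "X \<longlonglongrightarrow> x"
      using Cauchy_convergent_iff convergent_def by blast
    then show ?thesis
      using tendsto_norm_zero[OF LIM_zero] by (auto simp: ipnorm)
  qed
qed (use cinner_commute in \<open>auto simp: cinner_add_left cinner_scaleC_left\<close>)

text \<open>Bounded operators on \<open>\<H>\<close> are the elements of \<^typ>\<open>'h \<Rightarrow>\<^sub>L 'h\<close> that are complex linear.
  The adjoint of such an operator exists and is unique (Riesz), so the choice below is
  determined.\<close>

definition cadjoint :: "('h::chilbert_space \<Rightarrow>\<^sub>L 'h) \<Rightarrow> ('h \<Rightarrow>\<^sub>L 'h)"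
  where "cadjoint A = (SOME B :: 'h \<Rightarrow>\<^sub>L 'h. \<forall>x y. cinner (A x) y = cinner x (B y))"

definition positive_op :: "('h::chilbert_space \<Rightarrow>\<^sub>L 'h) \<Rightarrow> bool"
  where "positive_op A \<longleftrightarrow> (\<forall>h. cinner (A h) h \<in> \<real>\<^sub>\<ge>\<^sub>0)"

text \<open>Positivity of the operator matrix \<open>[A i j]\<close>, \<open>i, j < n\<close>, acting on the \<open>n\<close>-fold direct
  sum of the Hilbert space.\<close>

definition positive_op_matrix :: "nat \<Rightarrow> (nat \<Rightarrow> nat \<Rightarrow> ('h::chilbert_space \<Rightarrow>\<^sub>L 'h)) \<Rightarrow> bool"
  where "positive_op_matrix n A \<longleftrightarrow>
    (\<forall>h :: nat \<Rightarrow> 'h. (\<Sum>i<n. cinner (\<Sum>j<n. A i j (h j)) (h i)) \<in> \<real>\<^sub>\<ge>\<^sub>0)"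

text \<open>Linearity on \<open>S\<close> and the adjoint on \<open>S\<close>; the latter is determined only on \<open>S\<close>.\<close>

definition clinear_on :: "'k::complex_vector set \<Rightarrow> ('k \<Rightarrow> 'k) \<Rightarrow> bool"
  where "clinear_on S A \<longleftrightarrow>
    (\<forall>x\<in>S. A x \<in> S) \<and> (\<forall>x\<in>S. \<forall>y\<in>S. A (x + y) = A x + A y) \<and> (\<forall>c. \<forall>x\<in>S. A (c *\<^sub>C x) = c *\<^sub>C A x)"

definition adjoint_on :: "'k set \<Rightarrow> ('k \<Rightarrow> 'k \<Rightarrow> complex) \<Rightarrow> ('k \<Rightarrow> 'k) \<Rightarrow> ('k \<Rightarrow> 'k)"
  where "adjoint_on S ip A =
    (SOME B. (\<forall>y\<in>S. B y \<in> S) \<and> (\<forall>x\<in>S. \<forall>y\<in>S. ip (A x) y = ip x (B y)))"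

text \<open>\<open>y\<close> is the orthogonal projection of \<open>x\<close> onto the subspace \<open>M\<close>.\<close>

definition is_orth_proj :: "('k::minus \<Rightarrow> 'k \<Rightarrow> complex) \<Rightarrow> 'k set \<Rightarrow> 'k \<Rightarrow> 'k \<Rightarrow> bool"
  where "is_orth_proj ip M x y \<longleftrightarrow> y \<in> M \<and> (\<forall>z\<in>M. ip (x - y) z = 0)"


section \<open>Right LCM semigroups\<close>

class right_lcm_semigroup = monoid_mult +
  assumes left_cancel: "p * a = p * b \<Longrightarrow> a = b"
    and right_lcm: "range (\<lambda>a. p * a) \<inter> range (\<lambda>a. q * a) = {} \<or>
      (\<exists>r. range (\<lambda>a. p * a) \<inter> range (\<lambda>a. q * a) = range (\<lambda>a. r * a))"

abbreviation right_ideal :: "'p::times \<Rightarrow> 'p set"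
  where "right_ideal p \<equiv> range (\<lambda>a. p * a)"

definition invertibles :: "'p::monoid_mult set"
  where "invertibles = {x. \<exists>y. x * y = 1 \<and> y * x = 1}"

definition descending_chain_condition :: "'p::monoid_mult itself \<Rightarrow> bool"
  where "descending_chain_condition _ \<longleftrightarrow>
    \<not> (\<exists>(x :: nat \<Rightarrow> 'p) y. \<forall>n. y n \<notin> invertibles \<and>
        (x n = x (Suc n) * y n \<or> x n = y n * x (Suc n)))"

definition minimal_elements :: "'p::monoid_mult set"
  where "minimal_elements =
    {x. x \<notin> invertibles \<and> (\<forall>y z. x = y * z \<longrightarrow> y \<in> invertibles \<or> z \<in> invertibles)}"

text \<open>\<open>join F\<close> is the set of least common right multiples of \<open>F\<close>; the intersection over the
  empty set is the whole semigroup, so \<open>join {}\<close> is the set of invertible elements.\<close>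

definition join :: "'p::monoid_mult set \<Rightarrow> 'p set"
  where "join F = {r. (\<Inter>x\<in>F. right_ideal x) = right_ideal r}"

definition left_quotient :: "'p::monoid_mult \<Rightarrow> 'p \<Rightarrow> 'p"
  where "left_quotient p s = (THE t. p * t = s)"

definition minimal_set :: "'p::monoid_mult set \<Rightarrow> bool"
  where "minimal_set P0 \<longleftrightarrow> minimal_elements \<subseteq> P0 \<and>
    (\<forall>x\<in>minimal_elements. \<forall>y\<in>P0. left_quotient x ` join {x, y} \<subseteq> P0 \<union> invertibles)"


section \<open>Representations and dilations\<close>

definition unital_contractive_rep :: "('p::monoid_mult \<Rightarrow> ('h::chilbert_space \<Rightarrow>\<^sub>L 'h)) \<Rightarrow> bool"
  where "unital_contractive_rep T \<longleftrightarrow>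
    (\<forall>p. clinear (blinfun_apply (T p))) \<and> T 1 = id_blinfun \<and>
    (\<forall>p q. T (p * q) = T p o\<^sub>L T q) \<and> (\<forall>p. norm (T p) \<le> 1)"

text \<open>Any two elements of \<open>join U\<close> differ by an invertible right factor, and \<open>T\<close> maps
  invertible elements to unitaries, so the choices in the next two definitions are immaterial.\<close>

definition TT_star_join :: "('p::monoid_mult \<Rightarrow> ('h::chilbert_space \<Rightarrow>\<^sub>L 'h)) \<Rightarrow> 'p set \<Rightarrow> ('h \<Rightarrow>\<^sub>L 'h)"
  where "TT_star_join T U =
    (if join U = {} then 0
     else let r = (SOME r. r \<in> join U) in T r o\<^sub>L cadjoint (T r))"

definition star_kernel :: "('p::monoid_mult \<Rightarrow> ('h::chilbert_space \<Rightarrow>\<^sub>L 'h)) \<Rightarrow> 'p \<Rightarrow> 'p \<Rightarrow> ('h \<Rightarrow>\<^sub>L 'h)"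
  where "star_kernel T p q =
    (if join {p, q} = {} then 0
     else let s = (SOME s. s \<in> join {p, q})
          in T (left_quotient p s) o\<^sub>L cadjoint (T (left_quotient q s)))"

definition Z :: "('p::monoid_mult \<Rightarrow> ('h::chilbert_space \<Rightarrow>\<^sub>L 'h)) \<Rightarrow> 'p set \<Rightarrow> ('h \<Rightarrow>\<^sub>L 'h)"
  where "Z T F = (\<Sum>U\<in>Pow F. (- 1) ^ card U *\<^sub>R TT_star_join T U)"

definition has_star_regular_dilation :: "('p::monoid_mult \<Rightarrow> ('h::chilbert_space \<Rightarrow>\<^sub>L 'h)) \<Rightarrow> bool"
  where "has_star_regular_dilation T \<longleftrightarrow>
    (\<forall>n (p :: nat \<Rightarrow> 'p). positive_op_matrix n (\<lambda>i j. star_kernel T (p i) (p j)))"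

definition isometric_rep_on ::
  "'k::complex_vector set \<Rightarrow> ('k \<Rightarrow> 'k \<Rightarrow> complex) \<Rightarrow> ('p::monoid_mult \<Rightarrow> 'k \<Rightarrow> 'k) \<Rightarrow> bool"
  where "isometric_rep_on S ip V \<longleftrightarrow>
    (\<forall>p. clinear_on S (V p) \<and> (\<forall>x\<in>S. ipnorm ip (V p x) = ipnorm ip x)) \<and>
    (\<forall>x\<in>S. V 1 x = x) \<and> (\<forall>p q. \<forall>x\<in>S. V (p * q) x = V p (V q x))"

definition nica_covariant_on ::
  "'k::complex_vector set \<Rightarrow> ('k \<Rightarrow> 'k \<Rightarrow> complex) \<Rightarrow> ('p::monoid_mult \<Rightarrow> 'k \<Rightarrow> 'k) \<Rightarrow> bool"
  where "nica_covariant_on S ip V \<longleftrightarrow>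
    (let VV_star = (\<lambda>p. V p \<circ> adjoint_on S ip (V p)) in
      (\<forall>p q r. right_ideal p \<inter> right_ideal q = right_ideal r \<longrightarrow>
        (\<forall>x\<in>S. VV_star p (VV_star q x) = VV_star r x)) \<and>
      (\<forall>p q. right_ideal p \<inter> right_ideal q = {} \<longrightarrow>
        (\<forall>x\<in>S. VV_star p (VV_star q x) = 0)))"

text \<open>The inclusion of the original space in the dilation space \<open>(S, ip)\<close> is given by a linear
  isometric embedding \<open>J\<close>.\<close>

definition minimal_isometric_nica_dilation ::
  "('p::monoid_mult \<Rightarrow> ('h::chilbert_space \<Rightarrow>\<^sub>L 'h)) \<Rightarrow> 'k::complex_vector set \<Rightarrow>
   ('k \<Rightarrow> 'k \<Rightarrow> complex) \<Rightarrow> ('h \<Rightarrow> 'k) \<Rightarrow> ('p \<Rightarrow> 'k \<Rightarrow> 'k) \<Rightarrow> bool"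
  where "minimal_isometric_nica_dilation T S ip J V \<longleftrightarrow>
    hilbert_space_on S ip \<and>
    clinear J \<and> range J \<subseteq> S \<and> (\<forall>h k. ip (J h) (J k) = cinner h k) \<and>
    isometric_rep_on S ip V \<and>
    (\<forall>p h. is_orth_proj ip (range J) (V p (J h)) (J (T p h))) \<and>
    (\<forall>x\<in>S. \<forall>e>0. \<exists>y\<in>cspan {V p (J h) | p h. True}. ipnorm ip (x - y) < e) \<and>
    nica_covariant_on S ip V"

text \<open>The type \<open>'k\<close> bounds the universe in which the dilation space is sought.\<close>

definition has_minimal_isometric_nica_dilation ::
  "'k::complex_vector itself \<Rightarrow> ('p::monoid_mult \<Rightarrow> ('h::chilbert_space \<Rightarrow>\<^sub>L 'h)) \<Rightarrow> bool"
  where "has_minimal_isometric_nica_dilation _ T \<longleftrightarrow>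
    (\<exists>(S :: 'k set) ip J V. minimal_isometric_nica_dilation T S ip J V)"

end

(*
  Write A p for T(p)^*, and let E_p be the range projection V(p)V(p)^* of a dilation V.

  A dilation determines the kernel: minimality makes H co-invariant, so Nica covariance gives
  K(p,q) = P_H V(p)^* V(q)|_H, which is positive definite. Conversely a positive definite K has a
  reproducing kernel Hilbert space of functions P -> H, on which V(r) maps K(.,q)h to K(.,rq)h; it is
  given by (V(r)f)(q) = T(q^-1 s) f(r^-1 s) for s in r v q, and its adjoint by f |-> f(r .).

  The compression to H of the product of the projections 1 - E_x, x in F, is Z(F). Decomposing the
  quadratic form of K along the atoms of the commuting projections E_{p_i} therefore writes it as a sum
  of values of forms Z(F), so K is positive definite iff Z(F) >= 0 for all finite F. Finally
  Z({xy} u F) = Z({x} u F) + T(x) Z({y} u x^-1(x v F)) T(x)^*, and the descending chain condition allows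
  an induction that splits off minimal left factors x until only elements of P0 remain.
*)

theory Submission
  imports Defs
begin

section \<open>Semi-inner products and the Riesz representation\<close>

text \<open>As long as K is not known to be positive there is no dilation, so the projections E_p
  are only a heuristic in the decomposition into atoms. The argument itself runs with real numbers:
  \<open>weight h X\<close> stands for the squared norm of E_X h, and operator identities become
  identities for alternating sums over subsets. Idempotence of a product of projections is
  \<open>alt_sum_Un\<close>, the partition of 1 into atoms is \<open>sum_alt_sum_disjoint\<close>.

  Splitting off x replaces F by preimages and \<open>h\<close> by \<open>A x h\<close>, so
  positivity has to be proved for all families and all vectors at once. A preimage can be empty or
  all of P. Both are harmless, and the condition on a minimal set keeps the remaining preimages of
  ideals of P0 among the ideals of P0.

  The reproducing kernel space is convenient because its elements are functions from P to H: the
  carrier lies in a type fixed in advance, null vectors of the kernel form disappear without a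
  quotient, and K(p,p) = 1 makes point evaluations contractive, so Cauchy sequences have pointwise
  limits.\<close>

locale semi_inner_product_on =
  fixes S :: "'k::complex_vector set" and ip :: "'k \<Rightarrow> 'k \<Rightarrow> complex"
  assumes csubspace: "csubspace S"
    and commute: "\<lbrakk>x \<in> S; y \<in> S\<rbrakk> \<Longrightarrow> ip x y = cnj (ip y x)"
    and add_left: "\<lbrakk>x \<in> S; y \<in> S; z \<in> S\<rbrakk> \<Longrightarrow> ip (x + y) z = ip x z + ip y z"
    and scaleC_left: "\<lbrakk>x \<in> S; y \<in> S\<rbrakk> \<Longrightarrow> ip (c *\<^sub>C x) y = c * ip x y"
    and nonneg: "x \<in> S \<Longrightarrow> ip x x \<in> \<real>\<^sub>\<ge>\<^sub>0"
begin

lemma zero_mem [simp]: "0 \<in> S"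
  using csubspace by (rule complex_vector.subspace_0)

lemma add_mem [simp]: "x \<in> S \<Longrightarrow> y \<in> S \<Longrightarrow> x + y \<in> S"
  using csubspace by (rule complex_vector.subspace_add)

lemma diff_mem [simp]: "x \<in> S \<Longrightarrow> y \<in> S \<Longrightarrow> x - y \<in> S"
  using csubspace by (rule complex_vector.subspace_diff)

lemma scaleC_mem [simp]: "x \<in> S \<Longrightarrow> c *\<^sub>C x \<in> S"
  using csubspace by (rule complex_vector.subspace_scale)

lemma sum_mem: "(\<And>i. i \<in> I \<Longrightarrow> f i \<in> S) \<Longrightarrow> sum f I \<in> S"
  using csubspace by (rule complex_vector.subspace_sum)

lemma add_right:
  assumes "x \<in> S" "y \<in> S" "z \<in> S"
  shows "ip z (x + y) = ip z x + ip z y"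
  using assms commute[of z "x + y"] commute[of z x] commute[of z y] by (simp add: add_left)

lemma scaleC_right:
  assumes "x \<in> S" "y \<in> S"
  shows "ip x (c *\<^sub>C y) = cnj c * ip x y"
  using assms commute[of x "c *\<^sub>C y"] commute[of x y] by (simp add: scaleC_left)

lemma diff_left:
  assumes "x \<in> S" "y \<in> S" "z \<in> S"
  shows "ip (x - y) z = ip x z - ip y z"
  using add_left[of "x - y" y z] assms by (simp add: algebra_simps)

lemma diff_right:
  assumes "x \<in> S" "y \<in> S" "z \<in> S"
  shows "ip z (x - y) = ip z x - ip z y"
  using add_right[of "x - y" y z] assms by (simp add: algebra_simps)

lemma zero_left [simp]: "x \<in> S \<Longrightarrow> ip 0 x = 0"
  using add_left[of 0 0 x] by simp

lemma zero_right [simp]: "x \<in> S \<Longrightarrow> ip x 0 = 0"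
  using add_right[of 0 0 x] by simp

lemma sum_left:
  assumes "\<And>i. i \<in> I \<Longrightarrow> f i \<in> S" "x \<in> S"
  shows "ip (sum f I) x = (\<Sum>i\<in>I. ip (f i) x)"
  using assms
  by (induction I rule: infinite_finite_induct) (auto simp: add_left sum_mem)

lemma sum_right:
  assumes "\<And>i. i \<in> I \<Longrightarrow> f i \<in> S" "x \<in> S"
  shows "ip x (sum f I) = (\<Sum>i\<in>I. ip x (f i))"
  using assms
  by (induction I rule: infinite_finite_induct) (auto simp: add_right sum_mem)

lemma self_eq:
  assumes "x \<in> S"
  shows "ip x x = complex_of_real ((ipnorm ip x)\<^sup>2)"
proof -
  have "Im (ip x x) = 0" "Re (ip x x) \<ge> 0"
    using nonneg[OF assms] by (auto simp: complex_nonneg_Reals_iff)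
  then show ?thesis
    by (simp add: ipnorm_def complex_eq_iff)
qed

lemma Re_self: "x \<in> S \<Longrightarrow> Re (ip x x) = (ipnorm ip x)\<^sup>2"
  by (simp add: self_eq)

lemma ipnorm_nonneg [simp]: "x \<in> S \<Longrightarrow> 0 \<le> ipnorm ip x"
  using nonneg[of x] by (auto simp: ipnorm_def complex_nonneg_Reals_iff)

lemma ipnorm_zero [simp]: "ipnorm ip 0 = 0"
  by (simp add: ipnorm_def)

lemma ipnorm_scaleC:
  assumes "x \<in> S"
  shows "ipnorm ip (c *\<^sub>C x) = cmod c * ipnorm ip x"
proof -
  have "ip (c *\<^sub>C x) (c *\<^sub>C x) = complex_of_real ((cmod c)\<^sup>2 * (ipnorm ip x)\<^sup>2)"
    using assms complex_norm_square[of c]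
    by (simp add: scaleC_left scaleC_right self_eq[OF assms] mult.assoc[symmetric])
  then show ?thesis
    using assms by (simp add: ipnorm_def[of ip "c *\<^sub>C x"] real_sqrt_mult)
qed

lemma ipnorm_add_sq:
  assumes "x \<in> S" "y \<in> S"
  shows "(ipnorm ip (x + y))\<^sup>2 = (ipnorm ip x)\<^sup>2 + 2 * Re (ip x y) + (ipnorm ip y)\<^sup>2"
  using assms commute[of y x]
  by (simp add: Re_self[symmetric] add_left add_right)

lemma ipnorm_diff_sq:
  assumes "x \<in> S" "y \<in> S"
  shows "(ipnorm ip (x - y))\<^sup>2 = (ipnorm ip x)\<^sup>2 - 2 * Re (ip x y) + (ipnorm ip y)\<^sup>2"
  using assms commute[of y x]
  by (simp add: Re_self[symmetric] diff_left diff_right)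

lemma ipnorm_minus_commute:
  assumes "x \<in> S" "y \<in> S"
  shows "ipnorm ip (x - y) = ipnorm ip (y - x)"
proof -
  have "(ipnorm ip (x - y))\<^sup>2 = (ipnorm ip (y - x))\<^sup>2"
    using assms commute[of y x] by (simp add: ipnorm_diff_sq)
  then show ?thesis
    using assms by (simp add: power2_eq_iff_nonneg)
qed

text \<open>The form may be degenerate, so dividing by the squared norm of \<open>y\<close> has to
  be justified first.\<close>

lemma Cauchy_Schwarz:
  assumes x: "x \<in> S" and y: "y \<in> S"
  shows "cmod (ip x y) \<le> ipnorm ip x * ipnorm ip y"
proof (cases "ip x y = 0")
  case False
  define a b c where "a = (ipnorm ip x)\<^sup>2" and "b = (ipnorm ip y)\<^sup>2" and "c = (cmod (ip x y))\<^sup>2"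
  have c: "c > 0"
    using False by (simp add: c_def)
  \<comment> \<open>This is the squared norm of \<open>x\<close> minus \<open>t * ip x y\<close>
    times \<open>y\<close>.\<close>
  have quad: "0 \<le> a - 2 * t * c + t\<^sup>2 * c * b" for t
  proof -
    have "ip x ((complex_of_real t * ip x y) *\<^sub>C y) = complex_of_real (t * c)"
      using complex_norm_square[of "ip x y"] x y
      by (simp add: scaleC_right c_def mult.commute)
    moreover have "(ipnorm ip ((complex_of_real t * ip x y) *\<^sub>C y))\<^sup>2 = t\<^sup>2 * c * b"
      using y by (simp add: ipnorm_scaleC norm_mult power_mult_distrib c_def b_def)
    moreover have "0 \<le> (ipnorm ip (x - (complex_of_real t * ip x y) *\<^sub>C y))\<^sup>2"
      by simp
    ultimately show ?thesis
      using x y by (simp add: ipnorm_diff_sq a_def)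
  qed
  \<comment> \<open>For b = 0 the bound is affine in t with negative slope; at the value of t used
    here it would read 0 \<le> -1.\<close>
  have "b \<noteq> 0"
  proof
    assume "b = 0"
    then show False
      using quad[of "(a + 1) / (2 * c)"] c by simp
  qed
  then have "b > 0"
    by (simp add: b_def)
  then have "c \<le> a * b"
    using quad[of "1 / b"] by (simp add: power2_eq_square field_simps)
  then have "(cmod (ip x y))\<^sup>2 \<le> (ipnorm ip x * ipnorm ip y)\<^sup>2"
    by (simp add: a_def b_def c_def power_mult_distrib)
  then show ?thesis
    by (rule power2_le_imp_le) (use x y in auto)
qed (use x y in auto)

lemma ipnorm_triangle:
  assumes "x \<in> S" "y \<in> S"
  shows "ipnorm ip (x + y) \<le> ipnorm ip x + ipnorm ip y"
proof (rule power2_le_imp_le)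
  have "Re (ip x y) \<le> ipnorm ip x * ipnorm ip y"
    using Cauchy_Schwarz[OF assms] complex_Re_le_cmod[of "ip x y"] by linarith
  then show "(ipnorm ip (x + y))\<^sup>2 \<le> (ipnorm ip x + ipnorm ip y)\<^sup>2"
    using assms by (simp add: ipnorm_add_sq power2_sum)
qed (use assms in auto)

lemma ipnorm_triangle_diff:
  assumes "x \<in> S" "y \<in> S" "z \<in> S"
  shows "ipnorm ip (x - z) \<le> ipnorm ip (x - y) + ipnorm ip (y - z)"
  using ipnorm_triangle[of "x - y" "y - z"] assms by simp

lemma ipnorm_parallelogram:
  assumes "x \<in> S" "y \<in> S"
  shows "(ipnorm ip (x - y))\<^sup>2 = 2 * (ipnorm ip x)\<^sup>2 + 2 * (ipnorm ip y)\<^sup>2 - (ipnorm ip (x + y))\<^sup>2"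
  using assms by (simp add: ipnorm_add_sq ipnorm_diff_sq)

text \<open>Polarisation: the norm of a sum determines the real part, and replacing \<open>x\<close>
  by its multiple by the imaginary unit turns the imaginary part into a real one.\<close>

lemma isometry_preserves_ip:
  assumes lin: "clinear_on S A" and iso: "\<And>x. x \<in> S \<Longrightarrow> ipnorm ip (A x) = ipnorm ip x"
    and x: "x \<in> S" and y: "y \<in> S"
  shows "ip (A x) (A y) = ip x y"
proof -
  have mem: "A z \<in> S" if "z \<in> S" for z
    using lin that by (simp add: clinear_on_def)
  have Re: "Re (ip (A u) (A v)) = Re (ip u v)" if "u \<in> S" "v \<in> S" for u v
    using ipnorm_add_sq[of u v] ipnorm_add_sq[of "A u" "A v"] lin iso[of u] iso[of v] iso[of "u + v"] that
    by (simp add: mem clinear_on_def)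
  have "Re (ip (A (\<i> *\<^sub>C x)) (A y)) = Re (ip (\<i> *\<^sub>C x) y)"
    by (rule Re) (use x y in auto)
  then have "Im (ip (A x) (A y)) = Im (ip x y)"
    using x y lin by (simp add: clinear_on_def scaleC_left mem)
  then show ?thesis
    using Re[OF x y] by (simp add: complex_eq_iff)
qed

end

sublocale hilbert_space_on \<subseteq> semi_inner_product_on S ip
  by unfold_locales (fact subspace, (fact ip_commute ip_add_left ip_scaleC_left ip_nonneg)+)

context hilbert_space_on
begin

lemma ipnorm_eq_0_iff: "x \<in> S \<Longrightarrow> ipnorm ip x = 0 \<longleftrightarrow> x = 0"
  using ip_definite[of x] by (auto simp: self_eq)

lemma eqI_ip:
  assumes "x \<in> S" "y \<in> S" and "\<And>z. z \<in> S \<Longrightarrow> ip z x = ip z y"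
  shows "x = y"
  using assms(3)[of "x - y"] assms(1,2) ip_definite[of "x - y"]
  by (simp add: diff_right)

text \<open>The representing vector minimises \<open>\<parallel>x\<parallel>\<^sup>2 - 2 Re (\<phi> x)\<close>; by the parallelogram
  law minimising sequences are Cauchy.\<close>

lemma Riesz_representation:
  fixes \<phi> :: "'k \<Rightarrow> complex"
  assumes add: "\<And>x y. x \<in> S \<Longrightarrow> y \<in> S \<Longrightarrow> \<phi> (x + y) = \<phi> x + \<phi> y"
    and scale: "\<And>c x. x \<in> S \<Longrightarrow> \<phi> (c *\<^sub>C x) = c * \<phi> x"
    and bound: "\<And>x. x \<in> S \<Longrightarrow> cmod (\<phi> x) \<le> C * ipnorm ip x"
  shows "\<exists>y\<in>S. \<forall>x\<in>S. \<phi> x = ip x y"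
proof -
  define E where "E x = (ipnorm ip x)\<^sup>2 - 2 * Re (\<phi> x)" for x
  define m where "m = Inf (E ` S)"
  \<comment> \<open>Complete the square in \<open>ipnorm ip x - C\<close>.\<close>
  have lower: "- C\<^sup>2 \<le> E x" if "x \<in> S" for x
  proof -
    have "Re (\<phi> x) \<le> C * ipnorm ip x"
      using bound[OF that] complex_Re_le_cmod[of "\<phi> x"] by linarith
    then show ?thesis
      using zero_le_power2[of "ipnorm ip x - C"] by (simp add: E_def power2_diff mult.commute)
  qed
  then have bdd: "bdd_below (E ` S)"
    by (rule bdd_belowI2)
  have ne: "E ` S \<noteq> {}"
    using zero_mem by blast
  have m_le: "m \<le> E x" if "x \<in> S" for x
    unfolding m_def using bdd that by (rule cINF_lower)
  have "\<exists>x\<in>S. E x < m + 1 / real (Suc n)" for n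
  proof -
    have "Inf (E ` S) < m + 1 / real (Suc n)"
      by (simp add: m_def)
    then show ?thesis
      using cInf_less_iff[OF ne bdd] by blast
  qed
  then obtain X where X: "\<And>n. X n \<in> S" and EX: "\<And>n. E (X n) < m + 1 / real (Suc n)"
    by metis
  have dist: "(ipnorm ip (X i - X j))\<^sup>2 \<le> 2 / real (Suc i) + 2 / real (Suc j)" for i j
  proof -
    \<comment> \<open>The midpoint: since \<open>E z\<close> cannot fall below \<open>m\<close>, the
      parallelogram law leaves only the excesses of \<open>E (X i)\<close> and
      \<open>E (X j)\<close> over \<open>m\<close>.\<close>
    define z where "z = (1/2) *\<^sub>C (X i + X j)"
    have z: "z \<in> S" "(ipnorm ip (X i + X j))\<^sup>2 = 4 * (ipnorm ip z)\<^sup>2"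
      "Re (\<phi> z) = (Re (\<phi> (X i)) + Re (\<phi> (X j))) / 2"
      using X by (simp_all add: z_def ipnorm_scaleC scale add power_divide)
    have "(ipnorm ip (X i - X j))\<^sup>2 = 2 * E (X i) + 2 * E (X j) - 4 * E z"
      using X z by (simp add: ipnorm_parallelogram E_def)
    then show ?thesis
      using m_le[OF z(1)] EX[of i] EX[of j] by simp
  qed
  have "\<exists>N. \<forall>i\<ge>N. \<forall>j\<ge>N. ipnorm ip (X i - X j) < e" if "e > 0" for e
  proof -
    \<comment> \<open>With this \<open>N\<close> each of the two summands in \<open>dist\<close> is
      below half of the square of e.\<close>
    obtain N where N: "4 / e\<^sup>2 < real N"
      using reals_Archimedean2 by blast
    have "ipnorm ip (X i - X j) < e" if "i \<ge> N" "j \<ge> N" for i j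
    proof (rule power2_less_imp_less)
      have "real N > 0"
        using N \<open>e > 0\<close> by (meson divide_pos_pos less_trans zero_less_numeral zero_less_power)
      have "2 / real (Suc k) < e\<^sup>2 / 2" if "k \<ge> N" for k
      proof -
        have "4 / e\<^sup>2 < real (Suc k)"
          using N that by linarith
        then show ?thesis
          using \<open>e > 0\<close> by (simp add: field_simps del: of_nat_Suc)
      qed
      from this[OF that(1)] this[OF that(2)] dist[of i j]
      show "(ipnorm ip (X i - X j))\<^sup>2 < e\<^sup>2"
        by linarith
    qed (use \<open>e > 0\<close> in auto)
    then show ?thesis by blast
  qed
  then obtain y where y: "y \<in> S" and lim: "(\<lambda>n. ipnorm ip (X n - y)) \<longlonglongrightarrow> 0"
    using ip_complete[of X] X by blast
  \<comment> \<open>\<open>E\<close> is continuous along the sequence: its change is bounded by a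
    constant times the distance to \<open>y\<close>.\<close>
  have "E y \<le> m"
  proof (rule LIMSEQ_le_const)
    have E_diff: "E y \<le> E (X n) + (2 * ipnorm ip y + 2 * C) * ipnorm ip (X n - y)" for n
    proof -
      have "X n = y + (X n - y)" by simp
      then have "E (X n) = E y + 2 * Re (ip y (X n - y)) + (ipnorm ip (X n - y))\<^sup>2 - 2 * Re (\<phi> (X n - y))"
        using X y ipnorm_add_sq[of y "X n - y"] add[of y "X n - y"] by (simp add: E_def)
      moreover have "- Re (ip y (X n - y)) \<le> ipnorm ip y * ipnorm ip (X n - y)"
        using Cauchy_Schwarz[of y "X n - y"] abs_Re_le_cmod[of "ip y (X n - y)"] X y by simp
      moreover have "Re (\<phi> (X n - y)) \<le> C * ipnorm ip (X n - y)"
        using bound[of "X n - y"] complex_Re_le_cmod[of "\<phi> (X n - y)"] X y by simp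
      ultimately show ?thesis
        using zero_le_power2[of "ipnorm ip (X n - y)"] unfolding distrib_right by linarith
    qed
    have inv: "(\<lambda>n. 1 / real (Suc n)) \<longlonglongrightarrow> 0"
      using LIMSEQ_inverse_real_of_nat by (simp add: inverse_eq_divide)
    have "(\<lambda>n. m + 1 / real (Suc n) + (2 * ipnorm ip y + 2 * C) * ipnorm ip (X n - y))
        \<longlonglongrightarrow> m + 0 + (2 * ipnorm ip y + 2 * C) * 0"
      by (intro tendsto_intros lim inv)
    then show "(\<lambda>n. m + 1 / real (Suc n) + (2 * ipnorm ip y + 2 * C) * ipnorm ip (X n - y)) \<longlonglongrightarrow> m"
      by simp
    show "\<exists>N. \<forall>n\<ge>N. E y \<le> m + 1 / real (Suc n) + (2 * ipnorm ip y + 2 * C) * ipnorm ip (X n - y)"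
      using E_diff EX by (intro exI[of _ 0] allI impI) (meson add_right_mono less_imp_le order_trans)
  qed
  have Re_eq: "Re (\<phi> x) = Re (ip x y)" if x: "x \<in> S" for x
  proof (rule ccontr)
    assume neq: "Re (\<phi> x) \<noteq> Re (ip x y)"
    define d where "d = Re (\<phi> x) - Re (ip x y)"
    define b where "b = (ipnorm ip x)\<^sup>2"
    have quad: "2 * t * d \<le> t\<^sup>2 * b" for t
    proof -
      have "E y \<le> E (y + complex_of_real t *\<^sub>C x)"
        using \<open>E y \<le> m\<close> m_le[of "y + complex_of_real t *\<^sub>C x"] x y by simp
      then show ?thesis
        using x y commute[of y x]
        by (simp add: E_def ipnorm_add_sq add scale ipnorm_scaleC scaleC_right power_mult_distrib
            d_def b_def algebra_simps)
    qed
    have "d \<noteq> 0" using neq by (simp add: d_def)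
    have "b \<ge> 0" by (simp add: b_def)
    \<comment> \<open>Near t = 0 the linear term of the variation dominates unless d = 0. Taking b +
      1 instead of b in the denominator covers b = 0 as well.\<close>
    have "2 * (d / (b + 1)) * d \<le> (d / (b + 1))\<^sup>2 * b"
      by (rule quad)
    then have "2 * d\<^sup>2 * (b + 1) \<le> d\<^sup>2 * b"
      using \<open>b \<ge> 0\<close> by (simp add: power2_eq_square divide_simps)
    then have "d\<^sup>2 * (b + 2) \<le> 0" by (simp add: algebra_simps)
    moreover have "d\<^sup>2 * (b + 2) > 0"
      using \<open>d \<noteq> 0\<close> \<open>b \<ge> 0\<close> by (intro mult_pos_pos) auto
    ultimately show False by linarith
  qed
  \<comment> \<open>The imaginary parts follow from the real parts at the multiple of
    \<open>x\<close> by the imaginary unit.\<close>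
  have "\<phi> x = ip x y" if x: "x \<in> S" for x
    using Re_eq[OF x] Re_eq[of "\<i> *\<^sub>C x"] x y by (simp add: scale scaleC_left complex_eq_iff)
  then show ?thesis
    using y by blast
qed

text \<open>Riesz representation of the functional that pairs \<open>A x\<close> with a fixed
  \<open>y\<close>; it shows that the choice in the definition of \<open>adjoint_on\<close> is not
  vacuous.\<close>

lemma adjoint_on:
  assumes lin: "clinear_on S A" and bound: "\<And>x. x \<in> S \<Longrightarrow> ipnorm ip (A x) \<le> C * ipnorm ip x"
  shows adjoint_on_mem: "y \<in> S \<Longrightarrow> adjoint_on S ip A y \<in> S"
    and adjoint_on_ip: "x \<in> S \<Longrightarrow> y \<in> S \<Longrightarrow> ip (A x) y = ip x (adjoint_on S ip A y)"
proof -
  have mem: "A x \<in> S" if "x \<in> S" for x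
    using lin that by (simp add: clinear_on_def)
  have "\<exists>z\<in>S. \<forall>x\<in>S. ip (A x) y = ip x z" if y: "y \<in> S" for y
  proof (rule Riesz_representation)
    show "ip (A (x + x')) y = ip (A x) y + ip (A x') y" if "x \<in> S" "x' \<in> S" for x x'
      using lin that y by (simp add: clinear_on_def add_left)
    show "ip (A (c *\<^sub>C x)) y = c * ip (A x) y" if "x \<in> S" for c x
      using lin that y by (simp add: clinear_on_def scaleC_left)
    show "cmod (ip (A x) y) \<le> (C * ipnorm ip y) * ipnorm ip x" if "x \<in> S" for x
      using Cauchy_Schwarz[of "A x" y] mult_right_mono[OF bound[OF that], of "ipnorm ip y"] y mem[OF that]
      by (simp add: ac_simps)
  qed
  then obtain B where "\<forall>y\<in>S. B y \<in> S \<and> (\<forall>x\<in>S. ip (A x) y = ip x (B y))"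
    by metis
  then have "\<exists>B. (\<forall>y\<in>S. B y \<in> S) \<and> (\<forall>x\<in>S. \<forall>y\<in>S. ip (A x) y = ip x (B y))"
    by blast
  from someI_ex[OF this, folded adjoint_on_def]
  show "y \<in> S \<Longrightarrow> adjoint_on S ip A y \<in> S"
    and "x \<in> S \<Longrightarrow> y \<in> S \<Longrightarrow> ip (A x) y = ip x (adjoint_on S ip A y)"
    by auto
qed

end

section \<open>Adjoints of bounded operators on the original Hilbert space\<close>

interpretation cinner: hilbert_space_on "UNIV :: 'h::chilbert_space set" cinner
  by (rule hilbert_space_on_UNIV)

lemma ipnorm_cinner [simp]: "ipnorm cinner x = norm x"
  by (simp add: ipnorm_def Re_cinner norm_eq_sqrt_inner)

lemma cinner_self: "cinner x x = complex_of_real ((norm x)\<^sup>2)"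
  using cinner.self_eq[of x] by simp

lemma cinner_norm_le: "cmod (cinner x y) \<le> norm x * norm y"
  using cinner.Cauchy_Schwarz[of x y] by simp

lemma bounded_bilinear_cinner: "bounded_bilinear cinner"
proof
  show "cinner (r *\<^sub>R x) y = r *\<^sub>R cinner x y" for r :: real and x y :: 'a
    by (simp add: scaleR_scaleC cinner_scaleC_left scaleR_conv_of_real)
  show "cinner x (r *\<^sub>R y) = r *\<^sub>R cinner x y" for r :: real and x y :: 'a
    by (simp add: scaleR_scaleC cinner.scaleC_right scaleR_conv_of_real)
  show "\<exists>K. \<forall>a b :: 'a. cmod (cinner a b) \<le> norm a * norm b * K"
    by (intro exI[of _ 1]) (simp add: cinner_norm_le)
qed (simp_all add: cinner_add_left cinner.add_right)

lemmas tendsto_cinner = bounded_bilinear.tendsto[OF bounded_bilinear_cinner]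

lemma cinner_eqI: "(\<And>z. cinner z x = cinner z y) \<Longrightarrow> x = y"
  by (rule cinner.eqI_ip) auto

lemma cinner_eqI_left:
  assumes "\<And>z. cinner x z = cinner y z"
  shows "x = y"
proof (rule cinner_eqI)
  show "cinner z x = cinner z y" for z
    using assms[of z] cinner_commute[of z x] cinner_commute[of z y] by simp
qed

text \<open>The choice in \<open>cadjoint\<close> ranges over bounded operators only, so the
  pointwise adjoint from Riesz must be shown to be bounded; its norm is controlled by pairing
  \<open>A (B y)\<close> with \<open>y\<close>.\<close>

lemma cinner_cadjoint:
  assumes "clinear (blinfun_apply A)"
  shows "cinner (A x) y = cinner x (cadjoint A y)"
proof -
  interpret A: Vector_Spaces.linear scaleC scaleC "blinfun_apply A"
    by (rule assms)
  have lin: "clinear_on UNIV (blinfun_apply A)"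
    by (simp add: clinear_on_def A.add A.scale)
  have bound: "ipnorm cinner (A x) \<le> norm A * ipnorm cinner x" for x
    using norm_blinfun[of A x] by simp
  define B where "B = adjoint_on UNIV cinner (blinfun_apply A)"
  have B: "cinner (A x) y = cinner x (B y)" for x y
    unfolding B_def by (rule cinner.adjoint_on_ip[OF lin bound]) auto
  have norm_B: "norm (B y) \<le> norm A * norm y" for y
  proof -
    have "(norm (B y))\<^sup>2 = cmod (cinner (A (B y)) y)"
      by (simp only: B cinner_self norm_of_real abs_power2)
    also have "\<dots> \<le> norm (A (B y)) * norm y"
      by (rule cinner_norm_le)
    also have "\<dots> \<le> norm A * norm (B y) * norm y"
      by (intro mult_right_mono norm_blinfun) auto
    finally have "norm (B y) * norm (B y) \<le> norm (B y) * (norm A * norm y)"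
      by (simp add: power2_eq_square ac_simps)
    then show ?thesis
      by (cases "norm (B y) = 0") (auto simp: mult_le_cancel_left)
  qed
  have "bounded_linear B"
  proof (rule bounded_linear_intro)
    show "B (x + y) = B x + B y" for x y
      by (rule cinner_eqI) (simp add: B[symmetric] cinner.add_right)
    show "B (r *\<^sub>R x) = r *\<^sub>R B x" for r x
      by (rule cinner_eqI) (simp add: B[symmetric] cinner.scaleC_right scaleR_scaleC)
    show "norm (B x) \<le> norm x * norm A" for x
      using norm_B[of x] by (simp add: mult.commute)
  qed
  then have "\<exists>B :: 'a \<Rightarrow>\<^sub>L 'a. \<forall>x y. cinner (A x) y = cinner x (B y)"
    using B by (intro exI[of _ "Blinfun B"]) (simp add: bounded_linear_Blinfun_apply)
  from someI_ex[OF this, folded cadjoint_def] show ?thesis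
    by blast
qed

section \<open>Alternating sums over subsets\<close>

text \<open>Inclusion-exclusion: if \<open>f U\<close> measures the intersection of the members of
  \<open>U\<close>, the sum measures what lies in none of them.\<close>

definition alt_sum :: "'a set \<Rightarrow> ('a set \<Rightarrow> 'b::comm_ring_1) \<Rightarrow> 'b"
  where "alt_sum I f = (\<Sum>U\<in>Pow I. (- 1) ^ card U * f U)"

lemma alt_sum_empty [simp]: "alt_sum {} f = f {}"
  by (simp add: alt_sum_def)

lemma alt_sum_cong:
  assumes "\<And>U. U \<subseteq> I \<Longrightarrow> f U = g U"
  shows "alt_sum I f = alt_sum I g"
  unfolding alt_sum_def using assms by (intro sum.cong) auto

lemma alt_sum_diff: "alt_sum I (\<lambda>U. f U - g U) = alt_sum I f - alt_sum I g"
  by (simp add: alt_sum_def sum_subtractf right_diff_distrib)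

lemma alt_sum_zero [simp]: "alt_sum I (\<lambda>U. 0) = 0"
  by (simp add: alt_sum_def)

lemma alt_sum_sum: "alt_sum I (\<lambda>U. \<Sum>a\<in>A. f a U) = (\<Sum>a\<in>A. alt_sum I (f a))"
  by (simp add: alt_sum_def sum_distrib_left) (rule sum.swap)

lemma alt_sum_of_real: "alt_sum I (\<lambda>U. of_real (f U)) = of_real (alt_sum I f)"
  by (simp add: alt_sum_def)

lemma alt_sum_insert_notin:
  assumes "finite I" "x \<notin> I"
  shows "alt_sum (insert x I) f = alt_sum I f - alt_sum I (\<lambda>U. f (insert x U))"
proof -
  have inj: "inj_on (insert x) (Pow I)"
    using assms(2) by (auto simp: inj_on_def)
  have card: "card (insert x U) = Suc (card U)" if "U \<subseteq> I" for U
    using that assms by (meson card_insert_disjoint finite_subset subsetD)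
  have "alt_sum (insert x I) f
      = alt_sum I f + (\<Sum>U\<in>insert x ` Pow I. (- 1) ^ card U * f U)"
    unfolding alt_sum_def Pow_insert
    using assms by (intro sum.union_disjoint) auto
  also have "(\<Sum>U\<in>insert x ` Pow I. (- 1) ^ card U * f U) = - alt_sum I (\<lambda>U. f (insert x U))"
    by (simp add: sum.reindex[OF inj] alt_sum_def card flip: sum_negf)
  finally show ?thesis by simp
qed

text \<open>For \<open>x\<close> already in \<open>I\<close> the subtracted sum vanishes, because
  its terms cancel in pairs that differ only in \<open>x\<close>. So coinciding ideals need no
  separate treatment later.\<close>

lemma alt_sum_insert:
  assumes "finite I"
  shows "alt_sum (insert x I) f = alt_sum I f - alt_sum I (\<lambda>U. f (insert x U))"
proof (cases "x \<in> I")
  case True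
  then obtain J where J: "I = insert x J" "x \<notin> J"
    by (meson mk_disjoint_insert)
  have "alt_sum I (\<lambda>U. f (insert x U)) = 0"
    using assms J by (simp add: alt_sum_insert_notin)
  then show ?thesis
    using True by (simp add: insert_absorb)
qed (rule alt_sum_insert_notin[OF assms])

lemma alt_sum_image:
  assumes "finite I"
  shows "alt_sum I (\<lambda>U. f (g ` U)) = alt_sum (g ` I) f"
  using assms
proof (induction I arbitrary: f)
  case (insert x I)
  have "alt_sum I (\<lambda>U. f (insert (g x) (g ` U))) = alt_sum (g ` I) (\<lambda>V. f (insert (g x) V))"
    by (rule insert.IH)
  then show ?case
    using insert by (simp add: alt_sum_insert)
qed simp

text \<open>The expanded form of the fact that a product of commuting projections 1 - E_i is
  idempotent.\<close>

lemma alt_sum_Un: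
  assumes "finite I"
  shows "alt_sum I (\<lambda>U. alt_sum I (\<lambda>W. f (U \<union> W))) = alt_sum I f"
  using assms
proof (induction I arbitrary: f)
  case (insert x I)
  show ?case
    using insert.hyps insert.IH[of f] insert.IH[of "\<lambda>U. f (insert x U)"]
    by (simp add: alt_sum_insert alt_sum_diff)
qed simp

text \<open>The atoms of commuting projections sum to 1. In the induction each old atom splits into
  its parts under E_x and 1 - E_x.\<close>

lemma sum_alt_sum_disjoint:
  assumes "finite J"
  shows "(\<Sum>U\<in>Pow J. alt_sum (J - U) (\<lambda>W. f (U \<union> W))) = f {}"
  using assms
proof (induction J arbitrary: f)
  case (insert x J)
  have inj: "inj_on (insert x) (Pow J)"
    using insert.hyps by (auto simp: inj_on_def)
  have "(\<Sum>U\<in>Pow (insert x J). alt_sum (insert x J - U) (\<lambda>W. f (U \<union> W)))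
      = (\<Sum>U\<in>Pow J. alt_sum (insert x J - U) (\<lambda>W. f (U \<union> W)))
        + (\<Sum>U\<in>insert x ` Pow J. alt_sum (insert x J - U) (\<lambda>W. f (U \<union> W)))"
    unfolding Pow_insert using insert.hyps by (intro sum.union_disjoint) auto
  also have "(\<Sum>U\<in>Pow J. alt_sum (insert x J - U) (\<lambda>W. f (U \<union> W)))
      = (\<Sum>U\<in>Pow J. alt_sum (J - U) (\<lambda>W. f (U \<union> W)) - alt_sum (J - U) (\<lambda>W. f (insert x (U \<union> W))))"
  proof (intro sum.cong refl)
    fix U assume "U \<in> Pow J"
    then have "insert x J - U = insert x (J - U)"
      using insert.hyps by auto
    then show "alt_sum (insert x J - U) (\<lambda>W. f (U \<union> W))
        = alt_sum (J - U) (\<lambda>W. f (U \<union> W)) - alt_sum (J - U) (\<lambda>W. f (insert x (U \<union> W)))"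
      using insert.hyps by (simp add: alt_sum_insert)
  qed
  also have "(\<Sum>U\<in>insert x ` Pow J. alt_sum (insert x J - U) (\<lambda>W. f (U \<union> W)))
      = (\<Sum>U\<in>Pow J. alt_sum (J - U) (\<lambda>W. f (insert x (U \<union> W))))"
    unfolding sum.reindex[OF inj] comp_def
  proof (intro sum.cong refl)
    fix U assume "U \<in> Pow J"
    have "insert x J - insert x U = J - U"
      using insert.hyps by auto
    then show "alt_sum (insert x J - insert x U) (\<lambda>W. f (insert x U \<union> W))
        = alt_sum (J - U) (\<lambda>W. f (insert x (U \<union> W)))"
      by simp
  qed
  finally show ?case
    using insert.IH[of f] by (simp add: sum_subtractf)
qed simp

text \<open>The same partition of unity below the projection E_S: the atoms that remain are those
  whose index set contains \<open>S\<close>.\<close>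

lemma sum_alt_sum_superset:
  assumes "finite I" "S \<subseteq> I"
  shows "(\<Sum>U | S \<subseteq> U \<and> U \<subseteq> I. alt_sum (I - U) (\<lambda>W. f (U \<union> W))) = f S"
proof -
  have "(\<Sum>U | S \<subseteq> U \<and> U \<subseteq> I. alt_sum (I - U) (\<lambda>W. f (U \<union> W)))
      = (\<Sum>U\<in>Pow (I - S). alt_sum (I - S - U) (\<lambda>W. f (S \<union> (U \<union> W))))"
  proof (rule sum.reindex_bij_witness[where i = "\<lambda>U. S \<union> U" and j = "\<lambda>U. U - S"])
    fix U assume "U \<in> {U. S \<subseteq> U \<and> U \<subseteq> I}"
    then have "I - S - (U - S) = I - U" "S \<union> (U - S \<union> W) = U \<union> W" for W
      by auto
    then show "alt_sum (I - S - (U - S)) (\<lambda>W. f (S \<union> (U - S \<union> W))) = alt_sum (I - U) (\<lambda>W. f (U \<union> W))"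
      by simp
  qed (use assms in auto)
  also have "\<dots> = f S"
    using sum_alt_sum_disjoint[of "I - S" "\<lambda>U. f (S \<union> U)"] assms by simp
  finally show ?thesis .
qed

section \<open>Principal right ideals\<close>

lemma right_ideal_refl [simp]: "(r::'p::monoid_mult) \<in> right_ideal r"
  using mult_1_right[of r] by (metis rangeI)

lemma right_ideal_mult_subset: "right_ideal (p * q) \<subseteq> right_ideal (p::'p::monoid_mult)"
  by (auto simp: mult.assoc)

lemma image_right_ideal: "(*) s ` right_ideal r = right_ideal (s * r::'p::monoid_mult)"
  by (auto simp: mult.assoc image_image)

text \<open>From x y x = x, left cancellation makes a right inverse two-sided.\<close>

lemma invertiblesI:
  fixes x :: "'p::right_lcm_semigroup"
  assumes "x * y = 1"
  shows "x \<in> invertibles" "y \<in> invertibles"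
proof -
  have "x * (y * x) = x * 1"
    by (simp add: assms flip: mult.assoc)
  then have "y * x = 1"
    by (rule left_cancel)
  then show "x \<in> invertibles" "y \<in> invertibles"
    using assms by (auto simp: invertibles_def)
qed

lemma right_ideal_eq_UNIV_iff:
  fixes x :: "'p::right_lcm_semigroup"
  shows "right_ideal x = UNIV \<longleftrightarrow> x \<in> invertibles"
proof
  assume "right_ideal x = UNIV"
  then obtain y where "x * y = 1"
    by (metis UNIV_I imageE)
  then show "x \<in> invertibles"
    by (rule invertiblesI)
next
  assume "x \<in> invertibles"
  then obtain y where y: "x * y = 1"
    by (auto simp: invertibles_def)
  have "a = x * (y * a)" for a
    by (simp add: y flip: mult.assoc)
  then show "right_ideal x = UNIV"
    by blast
qed

text \<open>The source of every independence-of-representative argument below.\<close>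

lemma right_ideal_eq_imp_unit:
  fixes r :: "'p::right_lcm_semigroup"
  assumes "right_ideal r = right_ideal r'"
  obtains u v where "r' = r * u" "u * v = 1" "v * u = 1"
proof -
  have "r' \<in> right_ideal r" "r \<in> right_ideal r'"
    using assms right_ideal_refl by blast+
  then obtain u v where uv: "r' = r * u" "r = r' * v"
    by blast
  have "r * (u * v) = r * 1" "r' * (v * u) = r' * 1"
    using uv by (simp_all flip: mult.assoc)
  then have "u * v = 1" "v * u = 1"
    by (blast dest: left_cancel)+
  then show ?thesis
    using uv that by blast
qed

lemma left_quotient_mult [simp]: "left_quotient p (p * a) = (a::'p::right_lcm_semigroup)"
  unfolding left_quotient_def by (rule the_equality) (auto dest: left_cancel)

lemma mult_left_quotient:
  "s \<in> right_ideal p \<Longrightarrow> p * left_quotient p s = (s::'p::right_lcm_semigroup)"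
  by auto

text \<open>By the right LCM property this class is closed under finite intersections and under
  preimages of left multiplications; these are the ideals on which \<open>weight\<close> is
  meaningful.\<close>

definition empty_or_principal :: "'p::right_lcm_semigroup set \<Rightarrow> bool"
  where "empty_or_principal X \<longleftrightarrow> X = {} \<or> (\<exists>r. X = right_ideal r)"

lemma empty_or_principal_empty [simp]: "empty_or_principal {}"
  and empty_or_principal_right_ideal [simp]: "empty_or_principal (right_ideal r)"
  by (auto simp: empty_or_principal_def)

definition generator :: "'p::right_lcm_semigroup set \<Rightarrow> 'p"
  where "generator X = (SOME r. X = right_ideal r)"

lemma right_ideal_generator:
  assumes "empty_or_principal X" "X \<noteq> {}"
  shows "right_ideal (generator X) = X"
proof -
  obtain r where "X = right_ideal r"
    using assms by (auto simp: empty_or_principal_def)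
  then show ?thesis
    unfolding generator_def by (rule someI[of "\<lambda>r. X = right_ideal r", symmetric])
qed

lemma empty_or_principal_UNIV [simp]: "empty_or_principal UNIV"
  using empty_or_principal_right_ideal[of 1] by simp

lemma empty_or_principal_Int:
  assumes "empty_or_principal X" "empty_or_principal Y"
  shows "empty_or_principal (X \<inter> Y)"
proof (cases "X = {} \<or> Y = {}")
  case False
  then obtain p q where "X = right_ideal p" "Y = right_ideal q"
    using assms unfolding empty_or_principal_def by blast
  then show ?thesis
    unfolding empty_or_principal_def using right_lcm[of p q] by blast
qed auto

lemma empty_or_principal_Inter:
  "finite F \<Longrightarrow> (\<And>X. X \<in> F \<Longrightarrow> empty_or_principal X) \<Longrightarrow> empty_or_principal (\<Inter> F)"
  by (induction F rule: finite_induct) (auto simp: empty_or_principal_Int)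

lemma image_vimage_mult: "(*) s ` Y \<inter> X = (*) s ` (Y \<inter> (*) s -` X)"
  by auto

text \<open>Left multiplication by \<open>s\<close> is injective and maps the preimage of
  \<open>X\<close> onto its part inside sP. This expresses the left quotients of joins as an
  ideal.\<close>

lemma vimage_mult_Int_eq_right_ideal:
  fixes s :: "'p::right_lcm_semigroup"
  assumes "right_ideal s \<inter> X = right_ideal (s * b)"
  shows "(*) s -` X = right_ideal b"
proof -
  have "(*) s ` ((*) s -` X) = right_ideal s \<inter> X"
    by auto
  then have "(*) s ` ((*) s -` X) = (*) s ` right_ideal b"
    by (simp only: assms image_right_ideal)
  moreover have "inj ((*) s)"
    by (auto intro: injI left_cancel)
  ultimately show ?thesis
    using inj_image_eq_iff[of "(*) s"] by metis
qed

lemma empty_or_principal_vimage: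
  assumes "empty_or_principal X"
  shows "empty_or_principal ((*) s -` X)"
proof (cases "right_ideal s \<inter> X = {}")
  case True
  then have "(*) s -` X = {}"
    by auto
  then show ?thesis by simp
next
  case False
  then obtain t where t: "right_ideal s \<inter> X = right_ideal t"
    using empty_or_principal_Int[OF empty_or_principal_right_ideal assms, of s]
    by (auto simp: empty_or_principal_def)
  then have "t \<in> right_ideal s"
    by (metis IntD1 right_ideal_refl)
  then obtain b where "t = s * b"
    by blast
  then show ?thesis
    using vimage_mult_Int_eq_right_ideal[of s X b] t by simp
qed

lemma mem_join: "r \<in> join U \<longleftrightarrow> (\<Inter>x\<in>U. right_ideal x) = right_ideal r"
  by (simp add: join_def)

lemma mem_join_pair: "r \<in> join {p, q} \<longleftrightarrow> right_ideal p \<inter> right_ideal q = right_ideal r"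
  by (simp add: join_def)

lemma join_empty_iff:
  fixes U :: "'p::right_lcm_semigroup set"
  assumes "finite U"
  shows "join U = {} \<longleftrightarrow> (\<Inter>x\<in>U. right_ideal x) = {}"
proof -
  have "empty_or_principal (\<Inter>x\<in>U. right_ideal x)"
    using assms by (intro empty_or_principal_Inter) auto
  then show ?thesis
    by (auto simp: join_def empty_or_principal_def)
qed

section \<open>The functionals attached to a contractive representation\<close>

locale contractive_rep =
  fixes T :: "'p::right_lcm_semigroup \<Rightarrow> ('h::chilbert_space \<Rightarrow>\<^sub>L 'h)"
  assumes rep: "unital_contractive_rep T"
begin

abbreviation A :: "'p \<Rightarrow> ('h \<Rightarrow>\<^sub>L 'h)"
  where "A p \<equiv> cadjoint (T p)"

lemma T_clinear: "clinear (blinfun_apply (T p))"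
  using rep by (simp add: unital_contractive_rep_def)

lemma T_scaleC: "T p (c *\<^sub>C x) = c *\<^sub>C T p x"
  using T_clinear[of p] by (simp add: Vector_Spaces.linear_iff)

lemma T_one [simp]: "T 1 = id_blinfun"
  using rep by (simp add: unital_contractive_rep_def)

lemma T_mult: "T (p * q) x = T p (T q x)"
  using rep by (simp add: unital_contractive_rep_def)

lemma norm_T_le: "norm (T p x) \<le> norm x"
  using rep norm_blinfun[of "T p" x] mult_right_mono[of "norm (T p)" 1 "norm x"]
  by (auto simp: unital_contractive_rep_def intro: order_trans)

lemma cinner_T: "cinner (T p x) y = cinner x (A p y)"
  by (rule cinner_cadjoint[OF T_clinear])

lemma cinner_A: "cinner (A p x) y = cinner x (T p y)"
  using cinner_T[of p y x] cinner_commute[of "A p x" y] cinner_commute[of x "T p y"] by simp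

lemma A_scaleC: "A p (c *\<^sub>C x) = c *\<^sub>C A p x"
  by (rule cinner_eqI_left) (simp add: cinner_A cinner_scaleC_left)

lemma cadjoint_id [simp]: "cadjoint id_blinfun (x :: 'h) = x"
  by (rule cinner_eqI) (simp flip: cinner_T[of 1, simplified])

lemma A_mult: "A (p * q) x = A q (A p x)"
  by (rule cinner_eqI_left) (simp add: cinner_A T_mult)

lemma norm_A_le: "norm (A p x) \<le> norm x"
proof -
  have "(norm (A p x))\<^sup>2 = cmod (cinner (T p (A p x)) x)"
    by (simp only: cinner_T cinner_self norm_of_real abs_power2)
  also have "\<dots> \<le> norm (T p (A p x)) * norm x"
    by (rule cinner_norm_le)
  also have "\<dots> \<le> norm (A p x) * norm x"
    by (intro mult_right_mono norm_T_le) auto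
  finally show ?thesis
    by (cases "norm (A p x) = 0") (auto simp: power2_eq_square)
qed

lemma norm_A_unit:
  assumes "u * v = 1"
  shows "norm (A u x) = norm x"
proof (rule antisym)
  show "norm x \<le> norm (A u x)"
    using norm_A_le[of v "A u x"] by (simp add: assms flip: A_mult[of u v])
qed (rule norm_A_le)

text \<open>\<open>A u\<close> has the contraction \<open>A v\<close> as left inverse, hence is
  isometric and preserves inner products; moving one \<open>A u\<close> across gives the
  claim.\<close>

lemma T_A_unit:
  assumes "u * v = 1" "v * u = 1"
  shows "T u (A u x) = x"
proof (rule cinner_eqI_left)
  fix z
  have "cinner (A u x) (A u z) = cinner x z"
  proof (rule cinner.isometry_preserves_ip)
    show "clinear_on UNIV (blinfun_apply (A u))"
      by (simp add: clinear_on_def blinfun.add_right A_scaleC)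
    show "ipnorm cinner (A u y) = ipnorm cinner y" for y
      using norm_A_unit[OF assms(1)] by simp
  qed auto
  then show "cinner (T u (A u x)) z = cinner x z"
    by (simp add: cinner_T)
qed

text \<open>The extension of \<open>rP \<mapsto> \<parallel>T(r)\<^sup>* h\<parallel>\<^sup>2\<close> by \<open>0\<close> to the empty ideal; working with ideals
  instead of their generators makes the families \<open>x\<inverse>(x \<or> F)\<close> plain preimages.\<close>

definition weight :: "'h \<Rightarrow> 'p set \<Rightarrow> real"
  where "weight h X = (if X = {} then 0 else (norm (A (generator X) h))\<^sup>2)"

lemma weight_empty [simp]: "weight h {} = 0"
  by (simp add: weight_def)

text \<open>Two generators differ by an invertible right factor, which does not change the norm by
  \<open>norm_A_unit\<close>.\<close>

lemma weight_right_ideal: "weight h (right_ideal r) = (norm (A r h))\<^sup>2"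
proof -
  define r' where "r' = generator (right_ideal r)"
  have "right_ideal r = right_ideal r'"
    unfolding r'_def by (rule right_ideal_generator[symmetric]) auto
  then obtain u v where "r' = r * u" "u * v = 1"
    by (rule right_ideal_eq_imp_unit)
  then show ?thesis
    by (simp add: weight_def A_mult norm_A_unit flip: r'_def)
qed

lemma weight_image:
  assumes "empty_or_principal X"
  shows "weight h ((*) s ` X) = weight (A s h) X"
  using assms
  by (auto simp only: empty_or_principal_def image_right_ideal weight_right_ideal A_mult
      image_empty weight_empty)

definition zeta :: "'h \<Rightarrow> 'p set set \<Rightarrow> real"
  where "zeta h F = alt_sum F (\<lambda>U. weight h (\<Inter> U))"

lemma zeta_insert:
  "finite F \<Longrightarrow> zeta h (insert X F) = zeta h F - alt_sum F (\<lambda>U. weight h (X \<inter> \<Inter> U))"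
  by (simp add: zeta_def alt_sum_insert)

lemma zeta_insert_empty: "finite F \<Longrightarrow> zeta h (insert {} F) = zeta h F"
  by (simp add: zeta_insert)

text \<open>Inserting the whole semigroup subtracts the sum from itself, and here the insertion
  changes nothing.\<close>

lemma zeta_UNIV:
  assumes "finite F" "UNIV \<in> F"
  shows "zeta h F = 0"
  using zeta_insert[OF assms(1), of h UNIV] assms(2) by (simp add: insert_absorb zeta_def)

text \<open>Intersecting with a translate by \<open>s\<close> is the translate of the intersection
  with the preimage, and the weight of a translate is the weight for \<open>A s h\<close>.\<close>

lemma alt_sum_weight_image:
  assumes "finite F" "\<And>X. X \<in> F \<Longrightarrow> empty_or_principal X" "empty_or_principal Y"
  shows "alt_sum F (\<lambda>U. weight h ((*) s ` Y \<inter> \<Inter> U))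
    = alt_sum (vimage ((*) s) ` F) (\<lambda>V. weight (A s h) (Y \<inter> \<Inter> V))"
proof -
  have "alt_sum F (\<lambda>U. weight h ((*) s ` Y \<inter> \<Inter> U))
      = alt_sum F (\<lambda>U. weight (A s h) (Y \<inter> \<Inter> (vimage ((*) s) ` U)))"
  proof (rule alt_sum_cong)
    fix U assume "U \<subseteq> F"
    have eq: "Y \<inter> \<Inter> (vimage ((*) s) ` U) = Y \<inter> (*) s -` \<Inter> U"
      by auto
    have "empty_or_principal (Y \<inter> (*) s -` \<Inter> U)"
      using \<open>U \<subseteq> F\<close> assms finite_subset
      by (intro empty_or_principal_Int empty_or_principal_vimage empty_or_principal_Inter) auto
    then show "weight h ((*) s ` Y \<inter> \<Inter> U) = weight (A s h) (Y \<inter> \<Inter> (vimage ((*) s) ` U))"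
      by (simp add: eq image_vimage_mult weight_image)
  qed
  then show ?thesis
    using alt_sum_image[OF assms(1), of "\<lambda>V. weight (A s h) (Y \<inter> \<Inter> V)" "vimage ((*) s)"] by simp
qed

text \<open>In terms of the range projections \<open>E\<^sub>p\<close> of a dilation \<open>V\<close> this is the identity
  \<open>1 - E\<^sub>x\<^sub>y = (1 - E\<^sub>x) + V(x) (1 - E\<^sub>y) V(x)\<^sup>*\<close>.\<close>

lemma zeta_insert_mult:
  assumes "finite F" "\<And>X. X \<in> F \<Longrightarrow> empty_or_principal X"
  shows "zeta h (insert (right_ideal (x * y)) F)
    = zeta h (insert (right_ideal x) F) + zeta (A x h) (insert (right_ideal y) (vimage ((*) x) ` F))"
  using alt_sum_weight_image[OF assms, where s = x and Y = UNIV and h = h]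
    alt_sum_weight_image[OF assms, where s = x and Y = "right_ideal y" and h = h] assms(1)
  by (simp add: zeta_insert image_right_ideal) (simp add: zeta_def)

text \<open>Different elements of \<open>F\<close> may generate the same ideal;
  \<open>alt_sum_image\<close> shows that the passage to sets of ideals is unaffected.\<close>

lemma cinner_Z:
  assumes "finite F"
  shows "cinner (Z T F h) h = complex_of_real (zeta h (right_ideal ` F))"
proof -
  have term_eq: "cinner (TT_star_join T U h) h = complex_of_real (weight h (\<Inter> (right_ideal ` U)))"
    if "U \<subseteq> F" for U
  proof (cases "join U = {}")
    case True
    then show ?thesis
      using that assms finite_subset[of U F] by (simp add: TT_star_join_def join_empty_iff)
  next
    case False
    define r where "r = (SOME r. r \<in> join U)"
    have "r \<in> join U"
      using False some_in_eq[of "join U"] by (simp add: r_def)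
    then have "\<Inter> (right_ideal ` U) = right_ideal r"
      by (simp add: mem_join)
    moreover have "TT_star_join T U h = T r (A r h)"
      using False by (simp add: TT_star_join_def Let_def flip: r_def)
    ultimately show ?thesis
      by (simp only: weight_right_ideal cinner_T cinner_self)
  qed
  have "cinner (Z T F h) h = alt_sum F (\<lambda>U. cinner (TT_star_join T U h) h)"
    by (simp add: Z_def alt_sum_def blinfun.sum_left blinfun.scaleR_left cinner.sum_left
        scaleR_scaleC cinner_scaleC_left)
  also have "\<dots> = alt_sum F (\<lambda>U. complex_of_real (weight h (\<Inter> (right_ideal ` U))))"
    by (rule alt_sum_cong) (rule term_eq)
  also have "\<dots> = complex_of_real (alt_sum F (\<lambda>U. weight h (\<Inter> (right_ideal ` U))))"
    by (rule alt_sum_of_real)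
  also have "\<dots> = complex_of_real (zeta h (right_ideal ` F))"
    using alt_sum_image[OF assms, of "\<lambda>U. weight h (\<Inter> U)" right_ideal] by (simp add: zeta_def)
  finally show ?thesis .
qed

lemma positive_op_Z_iff:
  "finite F \<Longrightarrow> positive_op (Z T F) \<longleftrightarrow> (\<forall>h. 0 \<le> zeta h (right_ideal ` F))"
  by (simp add: positive_op_def cinner_Z)

end

section \<open>Reduction to a minimal set\<close>

text \<open>The sequences excluded by the chain condition are the infinite descents of this
  relation. It contains left and right factors, and both kinds of descent are used.\<close>

lemma wf_factors:
  assumes "descending_chain_condition TYPE('p::monoid_mult)"
  shows "wf {(a, b :: 'p). \<exists>c. c \<notin> invertibles \<and> (b = a * c \<or> b = c * a)}"
  unfolding wf_iff_no_infinite_down_chain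
proof
  assume "\<exists>f. \<forall>i. (f (Suc i), f i) \<in> {(a, b :: 'p). \<exists>c. c \<notin> invertibles \<and> (b = a * c \<or> b = c * a)}"
  then obtain f :: "nat \<Rightarrow> 'p" where
    "\<forall>i. \<exists>c. c \<notin> invertibles \<and> (f i = f (Suc i) * c \<or> f i = c * f (Suc i))"
    by auto
  then obtain y where "\<forall>i. y i \<notin> invertibles \<and> (f i = f (Suc i) * y i \<or> f i = y i * f (Suc i))"
    by metis
  then show False
    using assms by (auto simp: descending_chain_condition_def)
qed

text \<open>As long as p is not minimal, pass to the left factor of a factorisation into two
  non-invertible elements.\<close>

lemma minimal_left_factor:
  assumes "descending_chain_condition TYPE('p::monoid_mult)" and "(p::'p) \<notin> invertibles"
  shows "\<exists>x\<in>minimal_elements. \<exists>y. p = x * y"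
  using assms(2)
proof (induction p rule: wf_induct_rule[OF wf_factors[OF assms(1)]])
  case (1 p)
  show ?case
  proof (cases "p \<in> minimal_elements")
    case True
    then show ?thesis
      by (metis mult_1_right)
  next
    case False
    then obtain y z where yz: "p = y * z" "y \<notin> invertibles" "z \<notin> invertibles"
      using 1 by (auto simp: minimal_elements_def)
    then obtain x a where "x \<in> minimal_elements" "y = x * a"
      using "1.IH"[of y] by auto
    then show ?thesis
      using yz by (metis mult.assoc)
  qed
qed

text \<open>Here the quotient condition of a minimal set enters. The preimage is empty if there is
  no common multiple, and everything if the quotient is invertible.\<close>

lemma minimal_set_vimage:
  fixes P0 :: "'p::right_lcm_semigroup set"
  assumes "minimal_set P0" "x \<in> minimal_elements" "X \<in> right_ideal ` P0 \<union> {{}, UNIV}"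
  shows "(*) x -` X \<in> right_ideal ` P0 \<union> {{}, UNIV}"
proof (cases "X \<in> right_ideal ` P0")
  case True
  then obtain q where q: "q \<in> P0" "X = right_ideal q"
    by blast
  show ?thesis
  proof (cases "right_ideal x \<inter> X = {}")
    case True
    then have "(*) x -` X = {}"
      by auto
    then show ?thesis by simp
  next
    case False
    then obtain t where t: "right_ideal x \<inter> X = right_ideal t"
      using right_lcm[of x q] by (auto simp: q)
    then have "t \<in> join {x, q}"
      by (simp add: q mem_join_pair)
    then have b: "left_quotient x t \<in> P0 \<union> invertibles"
      using assms(1,2) q(1) unfolding minimal_set_def by blast
    have "t \<in> right_ideal x"
      using t by (metis IntD1 right_ideal_refl)
    then have "(*) x -` X = right_ideal (left_quotient x t)"
      using t by (intro vimage_mult_Int_eq_right_ideal) (simp add: mult_left_quotient)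
    then show ?thesis
      using b right_ideal_eq_UNIV_iff by auto
  qed
qed (use assms(3) in auto)

context contractive_rep
begin

text \<open>Lexicographic induction on the number of ideals outside the minimal set and on one
  generator outside it, from which minimal left factors are split off.\<close>

lemma zeta_nonneg_of_minimal_set:
  assumes dcc: "descending_chain_condition TYPE('p)" and P0: "minimal_set P0"
    and pos: "\<And>F h. finite F \<Longrightarrow> F \<subseteq> P0 \<Longrightarrow> 0 \<le> zeta h (right_ideal ` F)"
    and G: "finite G" "\<And>X. X \<in> G \<Longrightarrow> empty_or_principal X"
  shows "0 \<le> zeta h G"
proof -
  \<comment> \<open>With the empty set and the whole semigroup added, the ideals of
    \<open>P0\<close> are closed under preimages by minimal elements.\<close>
  define B where "B = right_ideal ` P0 \<union> {{}, UNIV}"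
  have B_eop: "empty_or_principal X" if "X \<in> B" for X
    using that by (auto simp: B_def)
  have base: "0 \<le> zeta h F" if F: "finite F" "F \<subseteq> B" for F h
  proof (cases "UNIV \<in> F")
    case False
    have "F - {{}} \<subseteq> right_ideal ` P0"
      using F False by (auto simp: B_def)
    then obtain F' where "F' \<subseteq> P0" "finite F'" "F - {{}} = right_ideal ` F'"
      using F by (metis finite_Diff finite_subset_image)
    then have "0 \<le> zeta h (F - {{}})"
      using pos by simp
    then show ?thesis
      using zeta_insert_empty[of "F - {{}}" h] F
      by (cases "{} \<in> F") (simp_all add: insert_absorb)
  qed (use F zeta_UNIV in simp)
  \<comment> \<open>\<open>F\<close> collects ideals already in \<open>B\<close>, and
    \<open>m\<close> bounds the size of the rest. A bound is more convenient than the exact size,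
    since preimages may identify members of \<open>G\<close>.\<close>
  have "0 \<le> zeta h (F \<union> G)"
    if "finite F" "F \<subseteq> B" "finite G" "\<And>X. X \<in> G \<Longrightarrow> empty_or_principal X" "card G \<le> m" for F G h m
    using that
  proof (induction m arbitrary: F G h)
    case 0
    then show ?case
      using base by simp
  next
    case (Suc m)
    \<comment> \<open>Stated for all \<open>F\<close>, \<open>G\<close> and \<open>h\<close>,
      because the recursion on \<open>p\<close> continues with preimages and with
      \<open>A x h\<close>.\<close>
    have insert_p: "0 \<le> zeta h (insert (right_ideal p) (F \<union> G))"
      if "finite F" "F \<subseteq> B" "finite G" "\<And>X. X \<in> G \<Longrightarrow> empty_or_principal X" "card G \<le> m" for p F G h
      using that
    proof (induction p arbitrary: F G h rule: wf_induct_rule[OF wf_factors[OF dcc]])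
      case (1 p)
      have fin: "finite (F \<union> G)" and eop: "\<And>X. X \<in> F \<union> G \<Longrightarrow> empty_or_principal X"
        using 1 B_eop by auto
      show ?case
      proof (cases "p \<in> invertibles")
        case True
        then have "right_ideal p = UNIV"
          by (simp add: right_ideal_eq_UNIV_iff)
        then show ?thesis
          using fin zeta_UNIV[of "insert UNIV (F \<union> G)"] by simp
      next
        case False
        then obtain x y where x: "x \<in> minimal_elements" and p: "p = x * y"
          using minimal_left_factor[OF dcc] by blast
        have "right_ideal x \<in> B"
          using x P0 by (auto simp: B_def minimal_set_def)
        \<comment> \<open>First summand of the splitting: the ideal of \<open>x\<close> joins
          \<open>F\<close>, so at most \<open>m\<close> ideals remain outside and the outer
          hypothesis applies.\<close>
        then have 1: "0 \<le> zeta h (insert (right_ideal x) F \<union> G)"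
          using "1.prems" Suc.IH[of "insert (right_ideal x) F" G] by auto
        \<comment> \<open>Second summand: the number of ideals outside need not drop, but
          \<open>y\<close> is a proper factor of \<open>p\<close> because the minimal
          \<open>x\<close> is not invertible.\<close>
        have "0 \<le> zeta (A x h) (insert (right_ideal y) (vimage ((*) x) ` F \<union> vimage ((*) x) ` G))"
        proof (rule "1.IH")
          show "empty_or_principal X" if "X \<in> vimage ((*) x) ` G" for X
            using that "1.prems"(4) empty_or_principal_vimage by blast
          show "(y, p) \<in> {(a, b). \<exists>c. c \<notin> invertibles \<and> (b = a * c \<or> b = c * a)}"
            using x p by (auto simp: minimal_elements_def)
          show "vimage ((*) x) ` F \<subseteq> B"
            using "1.prems"(2) minimal_set_vimage[OF P0 x, folded B_def] by (auto dest: subsetD)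
          show "card (vimage ((*) x) ` G) \<le> m"
            using "1.prems" card_image_le[of G "vimage ((*) x)"] by simp
        qed (use "1.prems" in auto)
        then show ?thesis
          using 1 zeta_insert_mult[OF fin eop, of h x y] by (simp add: p image_Un)
      qed
    qed
    show ?case
    proof (cases "G = {}")
      case True
      then show ?thesis
        using Suc.prems base by simp
    next
      case False
      then obtain X G' where G': "G = insert X G'" "X \<notin> G'"
        by (meson ex_in_conv mk_disjoint_insert)
      have prems: "finite G'" "\<And>X. X \<in> G' \<Longrightarrow> empty_or_principal X" "card G' \<le> m"
        using Suc.prems G' by auto
      have "X = {} \<or> (\<exists>p. X = right_ideal p)"
        using Suc.prems(4)[of X] G' by (simp add: empty_or_principal_def)
      then show ?thesis
      proof
        assume "X = {}"
        then show ?thesis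
          using Suc.IH[OF Suc.prems(1,2) prems, of h] zeta_insert_empty[of "F \<union> G'" h] prems(1) Suc.prems(1)
          by (simp add: G')
      next
        assume "\<exists>p. X = right_ideal p"
        then show ?thesis
          using insert_p[OF Suc.prems(1,2) prems] by (auto simp: G')
      qed
    qed
  qed
  from this[of "{}" G "card G" h] show ?thesis
    using G by simp
qed

end

lemmas cinner_scaleR_left = bounded_bilinear.scaleR_left[OF bounded_bilinear_cinner]
  and cinner_scaleR_right = bounded_bilinear.scaleR_right[OF bounded_bilinear_cinner]

lemma sum_in_nonneg_Reals:
  "(\<And>i. i \<in> I \<Longrightarrow> f i \<in> \<real>\<^sub>\<ge>\<^sub>0) \<Longrightarrow> sum f I \<in> (\<real>\<^sub>\<ge>\<^sub>0 :: complex set)"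
  by (induction I rule: infinite_finite_induct) (auto intro: nonneg_Reals_add_I)

section \<open>The kernel\<close>

context contractive_rep
begin

lemma star_kernel_disjoint:
  assumes "right_ideal p \<inter> right_ideal q = {}"
  shows "star_kernel T p q = 0"
  using assms by (simp add: star_kernel_def join_empty_iff)

text \<open>Replacing \<open>s\<close> by \<open>s * u\<close> with \<open>u\<close> invertible
  inserts T(u) times its adjoint between the two factors, which is the identity by
  \<open>T_A_unit\<close>.\<close>

lemma star_kernel_right_ideal:
  assumes s: "right_ideal p \<inter> right_ideal q = right_ideal s"
  shows "star_kernel T p q h = T (left_quotient p s) (A (left_quotient q s) h)"
proof -
  define s' where "s' = (SOME s. s \<in> join {p, q})"
  have "join {p, q} \<noteq> {}"
    using s mem_join_pair[of s p q] by auto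
  then have "s' \<in> join {p, q}"
    by (simp add: s'_def some_in_eq)
  then have "right_ideal s = right_ideal s'"
    using s by (simp add: mem_join_pair)
  then obtain u v where u: "s' = s * u" "u * v = 1" "v * u = 1"
    by (rule right_ideal_eq_imp_unit)
  have "s \<in> right_ideal p" "s \<in> right_ideal q"
    using s right_ideal_refl[of s] by blast+
  then obtain a b where ab: "s = p * a" "s = q * b"
    by blast
  have "s' = p * (a * u)" "s' = q * (b * u)"
    using ab u(1) by (simp_all flip: mult.assoc)
  then have "left_quotient p s' = a * u" "left_quotient q s' = b * u"
    by (metis left_quotient_mult)+
  moreover have "left_quotient p s = a" "left_quotient q s = b"
    using ab by (metis left_quotient_mult)+
  moreover have "star_kernel T p q h = T (left_quotient p s') (A (left_quotient q s') h)"
    using \<open>join {p, q} \<noteq> {}\<close> by (simp add: star_kernel_def Let_def flip: s'_def)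
  ultimately show ?thesis
    by (simp add: T_mult A_mult T_A_unit[OF u(2,3)])
qed

lemma cinner_star_kernel:
  assumes "right_ideal p \<inter> right_ideal q = right_ideal s"
  shows "cinner (star_kernel T p q h) k = cinner (A (left_quotient q s) h) (A (left_quotient p s) k)"
  by (simp add: star_kernel_right_ideal[OF assms] cinner_T)

lemma star_regular_imp_finite_psd:
  assumes "has_star_regular_dilation T" "finite I"
  shows "(\<Sum>i\<in>I. \<Sum>j\<in>I. cinner (star_kernel T (p i) (p j) (h j)) (h i)) \<in> \<real>\<^sub>\<ge>\<^sub>0"
proof -
  obtain e where e: "bij_betw e {..<card I} I"
    using ex_bij_betw_nat_finite[OF assms(2)] by (auto simp: atLeast0LessThan)
  have "(\<Sum>i\<in>I. \<Sum>j\<in>I. cinner (star_kernel T (p i) (p j) (h j)) (h i))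
      = (\<Sum>i<card I. \<Sum>j<card I. cinner (star_kernel T (p (e i)) (p (e j)) (h (e j))) (h (e i)))"
    by (simp flip: sum.reindex_bij_betw[OF e])
  also have "\<dots> = (\<Sum>i<card I. cinner (\<Sum>j<card I. star_kernel T (p (e i)) (p (e j)) (h (e j))) (h (e i)))"
    by (simp add: cinner.sum_left)
  also have "\<dots> \<in> \<real>\<^sub>\<ge>\<^sub>0"
    using assms(1)[unfolded has_star_regular_dilation_def positive_op_matrix_def,
        rule_format, of "\<lambda>i. p (e i)" "\<lambda>i. h (e i)" "card I"] .
  finally show ?thesis .
qed

text \<open>In a dilation, \<open>zeta h (right_ideal ` F)\<close> is the squared norm of
  \<open>(\<Prod>x\<in>F. 1 - E\<^sub>x) h\<close>; expanding the product gives the vectors used here.\<close>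

lemma star_regular_imp_zeta_nonneg:
  assumes reg: "has_star_regular_dilation T" and F: "finite F"
  shows "0 \<le> zeta h (right_ideal ` F)"
proof -
  define X where "X U = \<Inter> (right_ideal ` U)" for U :: "'p set"
  define r where "r U = generator (X U)" for U
  define c where "c U = ((- 1) ^ card U :: real)" for U :: "'p set"
  \<comment> \<open>Only subsets with a common multiple have a generator \<open>r U\<close>. The
    remaining subsets are added again below, with weight 0.\<close>
  define \<U> where "\<U> = {U \<in> Pow F. X U \<noteq> {}}"
  have fin: "finite (Pow F)"
    using F by simp
  have r: "right_ideal (r U) = X U" if "U \<in> \<U>" for U
    unfolding r_def X_def using that F
    by (intro right_ideal_generator empty_or_principal_Inter) (auto simp: \<U>_def X_def finite_subset)
  have X_Un: "X U \<inter> X W = X (U \<union> W)" for U W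
    by (auto simp: X_def)
  have term_eq: "cinner (star_kernel T (r U) (r W) (A (r W) h)) (A (r U) h)
      = complex_of_real (weight h (X (U \<union> W)))"
    if UW: "U \<in> \<U>" "W \<in> \<U>" for U W
  proof (cases "X (U \<union> W) = {}")
    case True
    then show ?thesis
      using UW by (simp add: star_kernel_disjoint r X_Un)
  next
    case False
    have UWF: "U \<union> W \<in> \<U>"
      using UW False by (auto simp: \<U>_def)
    define t where "t = r (U \<union> W)"
    have t: "right_ideal (r U) \<inter> right_ideal (r W) = right_ideal t"
      using r[OF UWF] UW by (simp add: r X_Un t_def)
    have "t \<in> right_ideal (r U)" "t \<in> right_ideal (r W)"
      using t right_ideal_refl[of t] by blast+
    then have "A (left_quotient (r W) t) (A (r W) h) = A t h" "A (left_quotient (r U) t) (A (r U) h) = A t h"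
      by (simp_all only: mult_left_quotient flip: A_mult)
    then show ?thesis
      using r[OF UWF] weight_right_ideal[of h t]
      by (simp add: cinner_star_kernel[OF t] cinner_self t_def)
  qed
  \<comment> \<open>The form of K at the points \<open>r U\<close> with vectors
    \<open>A (r U) h\<close>, signed by \<open>c U\<close>; in a dilation, V(r) maps
    \<open>A r h\<close> to E_r h.\<close>
  have "(\<Sum>U\<in>\<U>. \<Sum>W\<in>\<U>. cinner (star_kernel T (r U) (r W) (c W *\<^sub>R A (r W) h)) (c U *\<^sub>R A (r U) h)) \<in> \<real>\<^sub>\<ge>\<^sub>0"
    by (rule star_regular_imp_finite_psd[OF reg]) (simp add: \<U>_def F)
  also have "(\<Sum>U\<in>\<U>. \<Sum>W\<in>\<U>. cinner (star_kernel T (r U) (r W) (c W *\<^sub>R A (r W) h)) (c U *\<^sub>R A (r U) h))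
      = complex_of_real (\<Sum>U\<in>\<U>. \<Sum>W\<in>\<U>. c U * (c W * weight h (X (U \<union> W))))"
    by (simp add: blinfun.scaleR_right cinner_scaleR_left cinner_scaleR_right term_eq scaleR_conv_of_real
        mult.assoc cong: sum.cong)
  also have "(\<Sum>U\<in>\<U>. \<Sum>W\<in>\<U>. c U * (c W * weight h (X (U \<union> W))))
      = (\<Sum>U\<in>Pow F. \<Sum>W\<in>\<U>. c U * (c W * weight h (X (U \<union> W))))"
    using fin by (intro sum.mono_neutral_left) (auto simp: \<U>_def simp flip: X_Un)
  also have "\<dots> = (\<Sum>U\<in>Pow F. \<Sum>W\<in>Pow F. c U * (c W * weight h (X (U \<union> W))))"
    using fin by (intro sum.cong sum.mono_neutral_left) (auto simp: \<U>_def simp flip: X_Un)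
  also have "\<dots> = alt_sum F (\<lambda>U. alt_sum F (\<lambda>W. weight h (X (U \<union> W))))"
    by (simp add: alt_sum_def c_def sum_distrib_left)
  \<comment> \<open>Idempotence turns the double alternating sum into a single one.\<close>
  also have "\<dots> = zeta h (right_ideal ` F)"
    using alt_sum_Un[OF F, of "\<lambda>U. weight h (X U)"] alt_sum_image[OF F, of "\<lambda>U. weight h (\<Inter> U)" right_ideal]
    by (simp add: zeta_def X_def)
  finally show ?thesis
    by simp
qed

text \<open>The quadratic form of the kernel is decomposed along the atoms
  \<open>\<Prod>i\<in>U. E\<^sub>i \<cdot> \<Prod>i\<notin>U. 1 - E\<^sub>i\<close> of the projections onto the ideals \<open>p i P\<close>; each atom
  contributes one value of \<open>zeta\<close>.\<close>

lemma zeta_nonneg_imp_star_regular: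
  assumes pos: "\<And>k F. finite F \<Longrightarrow> (\<And>X. X \<in> F \<Longrightarrow> empty_or_principal X) \<Longrightarrow> 0 \<le> zeta k F"
  shows "has_star_regular_dilation T"
  unfolding has_star_regular_dilation_def positive_op_matrix_def
proof (intro allI)
  fix n :: nat and p :: "nat \<Rightarrow> 'p" and h :: "nat \<Rightarrow> 'h"
  define I where "I = {..<n}"
  have fin: "finite I"
    by (simp add: I_def)
  define X where "X V = (\<Inter>i\<in>V. right_ideal (p i))" for V
  define t where "t V = generator (X V)" for V
  define q where "q i V = left_quotient (p i) (t V)" for i V
  \<comment> \<open>For i and j in \<open>V\<close> this is, in a dilation, the inner product of E
    V(p_j) h_j with V(p_i) h_i, where E is the range projection for the ideal
    \<open>X V\<close>.\<close>
  define G where "G i j V = (if X V = {} then 0 else cinner (A (q j V) (h j)) (A (q i V) (h i)))" for i j V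
  have X_eop: "empty_or_principal (X V)" if "V \<subseteq> I" for V
    unfolding X_def using that fin finite_subset by (intro empty_or_principal_Inter) auto
  have t: "right_ideal (t V) = X V" if "V \<subseteq> I" "X V \<noteq> {}" for V
    unfolding t_def by (rule right_ideal_generator[OF X_eop]) (use that in auto)
  have pq: "p i * q i V = t V" if "V \<subseteq> I" "X V \<noteq> {}" "i \<in> V" for i V
  proof -
    have "t V \<in> X V"
      using t[OF that(1,2)] right_ideal_refl[of "t V"] by simp
    then have "t V \<in> right_ideal (p i)"
      using that by (auto simp: X_def)
    then show ?thesis
      unfolding q_def by (rule mult_left_quotient)
  qed
  have kernel: "cinner (star_kernel T (p i) (p j) (h j)) (h i) = G i j {i, j}" if "i \<in> I" "j \<in> I" for i j
  proof (cases "X {i, j} = {}")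
    case True
    then show ?thesis
      by (simp add: G_def X_def star_kernel_disjoint)
  next
    case False
    have "right_ideal (p i) \<inter> right_ideal (p j) = right_ideal (t {i, j})"
      using t[OF _ False] that by (simp add: X_def)
    from cinner_star_kernel[OF this] show ?thesis
      using False by (simp add: G_def q_def)
  qed
  have atom: "alt_sum (I - U) (\<lambda>W. \<Sum>i\<in>U. \<Sum>j\<in>U. G i j (U \<union> W)) \<in> \<real>\<^sub>\<ge>\<^sub>0" if U: "U \<subseteq> I" for U
  proof (cases "X U = {}")
    case True
    then have "X (U \<union> W) = {}" for W
      by (auto simp: X_def)
    then show ?thesis
      by (simp add: G_def)
  next
    case False
    define s where "s = t U"
    \<comment> \<open>In a dilation this is the adjoint of V(s) applied to the sum of the V(p_j)
      h_j. A single vector serves the whole atom.\<close>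
    define k where "k = (\<Sum>j\<in>U. A (q j U) (h j))"
    define Y where "Y i = (*) s -` right_ideal (p i)" for i
    have "empty_or_principal (Y i)" for i
      by (simp add: Y_def empty_or_principal_vimage)
    then have nonneg: "complex_of_real (zeta k (Y ` (I - U))) \<in> \<real>\<^sub>\<ge>\<^sub>0"
      using pos[of "Y ` (I - U)" k] fin by auto
    have "(\<Sum>i\<in>U. \<Sum>j\<in>U. G i j (U \<union> W)) = complex_of_real (weight k (\<Inter> (Y ` W)))" if W: "W \<subseteq> I - U" for W
    proof -
      have UW: "U \<union> W \<subseteq> I"
        using U W by auto
      have XUW: "right_ideal s \<inter> (\<Inter>i\<in>W. right_ideal (p i)) = X (U \<union> W)"
        using t[OF U False] by (auto simp: X_def s_def)
      have Y_eq: "\<Inter> (Y ` W) = (*) s -` (\<Inter>i\<in>W. right_ideal (p i))"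
        by (auto simp: Y_def)
      show ?thesis
      proof (cases "X (U \<union> W) = {}")
        case True
        then have "\<Inter> (Y ` W) = {}"
          using XUW unfolding Y_eq by auto
        then show ?thesis
          using True by (simp add: G_def)
      next
        case nonempty: False
        have "t (U \<union> W) \<in> right_ideal s"
          using XUW t[OF UW nonempty] right_ideal_refl[of "t (U \<union> W)"] by blast
        then obtain b where b: "t (U \<union> W) = s * b"
          by blast
        \<comment> \<open>Enlarging the index set multiplies all quotients by the same
          \<open>b\<close>, so \<open>A b\<close> comes out of the sums and a squared norm
          remains.\<close>
        have "q j (U \<union> W) = q j U * b" if "j \<in> U" for j
        proof (rule left_cancel)
          show "p j * q j (U \<union> W) = p j * (q j U * b)"
            using pq[OF UW nonempty, of j] pq[OF U False that] that b
            by (simp add: s_def flip: mult.assoc)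
        qed
        then have "(\<Sum>i\<in>U. \<Sum>j\<in>U. G i j (U \<union> W))
            = (\<Sum>i\<in>U. \<Sum>j\<in>U. cinner (A b (A (q j U) (h j))) (A b (A (q i U) (h i))))"
          using nonempty by (simp add: G_def A_mult)
        also have "\<dots> = cinner (A b k) (A b k)"
          by (simp add: k_def blinfun.sum_right cinner.sum_left cinner.sum_right)
        also have "\<dots> = complex_of_real (weight k (right_ideal b))"
          by (simp only: cinner_self weight_right_ideal)
        also have "right_ideal b = \<Inter> (Y ` W)"
          unfolding Y_eq
          by (rule vimage_mult_Int_eq_right_ideal[symmetric]) (use XUW t[OF UW nonempty] b in simp)
        finally show ?thesis .
      qed
    qed
    then have "alt_sum (I - U) (\<lambda>W. \<Sum>i\<in>U. \<Sum>j\<in>U. G i j (U \<union> W))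
        = alt_sum (I - U) (\<lambda>W. complex_of_real (weight k (\<Inter> (Y ` W))))"
      by (rule alt_sum_cong)
    also have "\<dots> = complex_of_real (zeta k (Y ` (I - U)))"
      using alt_sum_image[of "I - U" "\<lambda>U. weight k (\<Inter> U)" Y] fin
      by (simp add: alt_sum_of_real zeta_def)
    finally show ?thesis
      using nonneg by simp
  qed
  have "(\<Sum>i<n. cinner (\<Sum>j<n. star_kernel T (p i) (p j) (h j)) (h i)) = (\<Sum>i\<in>I. \<Sum>j\<in>I. G i j {i, j})"
    by (simp add: cinner.sum_left kernel flip: I_def cong: sum.cong)
  also have "\<dots> = (\<Sum>i\<in>I. \<Sum>j\<in>I. \<Sum>U\<in>Pow I. if i \<in> U \<and> j \<in> U then alt_sum (I - U) (\<lambda>W. G i j (U \<union> W)) else 0)"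
  proof (intro sum.cong refl)
    fix i j assume "i \<in> I" "j \<in> I"
    \<comment> \<open>The projection for the pair is the sum of the atoms whose index set contains
      both i and j.\<close>
    then have "G i j {i, j} = (\<Sum>U | {i, j} \<subseteq> U \<and> U \<subseteq> I. alt_sum (I - U) (\<lambda>W. G i j (U \<union> W)))"
      using sum_alt_sum_superset[OF fin, of "{i, j}" "G i j"] by simp
    also have "\<dots> = (\<Sum>U\<in>Pow I. if i \<in> U \<and> j \<in> U then alt_sum (I - U) (\<lambda>W. G i j (U \<union> W)) else 0)"
      using fin by (subst sum.inter_filter[symmetric]) (auto intro!: sum.cong)
    finally show "G i j {i, j} = \<dots>" .
  qed
  also have "\<dots> = (\<Sum>U\<in>Pow I. \<Sum>i\<in>I. \<Sum>j\<in>I. if i \<in> U \<and> j \<in> U then alt_sum (I - U) (\<lambda>W. G i j (U \<union> W)) else 0)"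
    by (simp only: sum.swap[where A = I and B = "Pow I"])
  also have "\<dots> = (\<Sum>U\<in>Pow I. alt_sum (I - U) (\<lambda>W. \<Sum>i\<in>U. \<Sum>j\<in>U. G i j (U \<union> W)))"
  proof (intro sum.cong refl)
    fix U assume "U \<in> Pow I"
    then have "(\<Sum>i\<in>I. \<Sum>j\<in>I. if i \<in> U \<and> j \<in> U then f i j else 0) = (\<Sum>i\<in>U. \<Sum>j\<in>U. f i j)"
      for f :: "nat \<Rightarrow> nat \<Rightarrow> complex"
      using fin by (intro sum.mono_neutral_cong_right) (auto intro!: sum.mono_neutral_cong_right)
    then show "(\<Sum>i\<in>I. \<Sum>j\<in>I. if i \<in> U \<and> j \<in> U then alt_sum (I - U) (\<lambda>W. G i j (U \<union> W)) else 0)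
        = alt_sum (I - U) (\<lambda>W. \<Sum>i\<in>U. \<Sum>j\<in>U. G i j (U \<union> W))"
      by (simp add: alt_sum_sum)
  qed
  also have "\<dots> \<in> \<real>\<^sub>\<ge>\<^sub>0"
    using atom by (intro sum_in_nonneg_Reals) auto
  finally show "(\<Sum>i<n. cinner (\<Sum>j<n. star_kernel T (p i) (p j) (h j)) (h i)) \<in> \<real>\<^sub>\<ge>\<^sub>0" .
qed

end

section \<open>From a dilation to the kernel\<close>

text \<open>A span element nearer to \<open>d\<close> than its own norm, being orthogonal to
  \<open>d\<close>, contradicts Cauchy-Schwarz.\<close>

lemma (in hilbert_space_on) orthogonal_to_dense_eq_0:
  assumes d: "d \<in> S" and G: "G \<subseteq> S" and orth: "\<And>g. g \<in> G \<Longrightarrow> ip g d = 0"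
    and dense: "\<And>x e. x \<in> S \<Longrightarrow> e > 0 \<Longrightarrow> \<exists>y\<in>cspan G. ipnorm ip (x - y) < e"
  shows "d = 0"
proof (rule ccontr)
  assume "d \<noteq> 0"
  then have pos: "ipnorm ip d > 0"
    using ipnorm_eq_0_iff[OF d] ipnorm_nonneg[OF d] by linarith
  have "csubspace {y \<in> S. ip y d = 0}"
    using d by (auto simp: complex_vector.subspace_def add_left scaleC_left)
  then have "cspan G \<subseteq> {y \<in> S. ip y d = 0}"
    using G orth by (intro complex_vector.span_minimal) auto
  then obtain y where y: "y \<in> S" "ip y d = 0" "ipnorm ip (d - y) < ipnorm ip d"
    using dense[OF d pos] by blast
  have "(ipnorm ip d)\<^sup>2 = cmod (ip (d - y) d)"
    using y d by (simp add: diff_left self_eq[OF d] norm_power)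
  also have "\<dots> \<le> ipnorm ip (d - y) * ipnorm ip d"
    using y d by (intro Cauchy_Schwarz) auto
  also have "\<dots> < ipnorm ip d * ipnorm ip d"
    using y(3) pos by (rule mult_strict_right_mono)
  finally show False
    by (simp add: power2_eq_square)
qed

lemma (in contractive_rep) dilation_imp_star_regular:
  assumes dil: "minimal_isometric_nica_dilation T S ip J V"
  shows "has_star_regular_dilation T"
proof -
  interpret hilbert_space_on S ip
    using dil by (simp add: minimal_isometric_nica_dilation_def)
  have J_mem [simp]: "J h \<in> S" for h
    using dil by (auto simp: minimal_isometric_nica_dilation_def)
  have J_ip: "ip (J h) (J k) = cinner h k" for h k
    using dil by (simp add: minimal_isometric_nica_dilation_def)
  have V_rep: "isometric_rep_on S ip V"
    using dil by (simp add: minimal_isometric_nica_dilation_def)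
  then have V_lin: "clinear_on S (V p)"
    and V_norm: "x \<in> S \<Longrightarrow> ipnorm ip (V p x) = ipnorm ip x"
    and V_mult: "x \<in> S \<Longrightarrow> V (p * q) x = V p (V q x)" for p q x
    by (auto simp: isometric_rep_on_def)
  have V_mem [simp]: "x \<in> S \<Longrightarrow> V p x \<in> S" for p x
    using V_lin by (simp add: clinear_on_def)
  have V_ip: "x \<in> S \<Longrightarrow> y \<in> S \<Longrightarrow> ip (V p x) (V p y) = ip x y" for p x y
    by (rule isometry_preserves_ip[OF V_lin V_norm])
  have dense: "\<exists>y\<in>cspan {V p (J h) | p h. True}. ipnorm ip (x - y) < e" if "x \<in> S" "e > 0" for x e
    using dil that by (simp add: minimal_isometric_nica_dilation_def)
  define W where "W p = adjoint_on S ip (V p)" for p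
  have V_bound: "ipnorm ip (V p x) \<le> 1 * ipnorm ip x" if "x \<in> S" for p x
    using V_norm[OF that] by simp
  have W_mem [simp]: "W p x \<in> S" if "x \<in> S" for p x
    unfolding W_def using adjoint_on_mem[OF V_lin V_bound that] .
  have W_ip: "ip (V p x) y = ip x (W p y)" if "x \<in> S" "y \<in> S" for p x y
    unfolding W_def using adjoint_on_ip[OF V_lin V_bound that] .
  have W_V: "W p (V p x) = x" if "x \<in> S" for p x
    by (rule eqI_ip) (use that in \<open>simp_all add: V_ip flip: W_ip\<close>)
  have W_mult: "W (p * q) x = W q (W p x)" if "x \<in> S" for p q x
    by (rule eqI_ip) (use that in \<open>simp_all add: V_mult flip: W_ip\<close>)
  have compression: "ip (V p (J h)) (J k) = cinner (T p h) k" for p h k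
  proof -
    have "is_orth_proj ip (range J) (V p (J h)) (J (T p h))"
      using dil by (simp add: minimal_isometric_nica_dilation_def)
    then show ?thesis
      by (simp add: is_orth_proj_def diff_left J_ip)
  qed
  \<comment> \<open>Minimality: the vectors \<open>V q (J h)\<close> have dense span, and against
    them both sides give the pairing of \<open>T (p * q) h\<close> with \<open>k\<close>.\<close>
  have W_J: "W p (J k) = J (A p k)" for p k
  proof -
    have "W p (J k) - J (A p k) = 0"
    proof (rule orthogonal_to_dense_eq_0[OF _ _ _ dense])
      fix g assume "g \<in> {V q (J h) | q h. True}"
      then obtain q h where g: "g = V q (J h)"
        by blast
      have "ip g (W p (J k)) = ip (V (p * q) (J h)) (J k)"
        by (simp add: g V_mult flip: W_ip)
      then show "ip g (W p (J k) - J (A p k)) = 0"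
        by (simp add: g diff_right compression T_mult cinner_T)
    qed auto
    then show ?thesis by simp
  qed
  have nica: "V p (W p (V q (W q x))) = V r (W r x)"
    if "right_ideal p \<inter> right_ideal q = right_ideal r" "x \<in> S" for p q r x
    using dil that by (auto simp: minimal_isometric_nica_dilation_def nica_covariant_on_def Let_def W_def)
  have nica_disjoint: "V p (W p (V q (W q x))) = 0"
    if "right_ideal p \<inter> right_ideal q = {}" "x \<in> S" for p q x
    using dil that by (auto simp: minimal_isometric_nica_dilation_def nica_covariant_on_def Let_def W_def)
  have kernel: "cinner (star_kernel T p q h) k = ip (V q (J h)) (V p (J k))" for p q h k
  proof -
    \<comment> \<open>\<open>V q (J h)\<close> is fixed by the range projection of \<open>q\<close>,
      and that of \<open>p\<close> can be moved onto \<open>V p (J k)\<close>, so their product may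
      be inserted.\<close>
    have flip: "ip (V q (J h)) (V p (J k)) = ip (V p (W p (V q (W q (V q (J h)))))) (V p (J k))"
      using W_ip[of "J k" "V q (J h)" p] commute[of "V q (J h)" "V p (J k)"]
        commute[of "W p (V q (J h))" "J k"]
      by (simp add: V_ip W_V)
    show ?thesis
    proof (cases "right_ideal p \<inter> right_ideal q = {}")
      case True
      then show ?thesis
        unfolding flip by (simp add: star_kernel_disjoint nica_disjoint)
    next
      case False
      then obtain s where s: "right_ideal p \<inter> right_ideal q = right_ideal s"
        using right_lcm[of p q] by blast
      define a b where "a = left_quotient p s" and "b = left_quotient q s"
      have "s \<in> right_ideal p" "s \<in> right_ideal q"
        using s right_ideal_refl[of s] by blast+
      then have ab: "s = p * a" "s = q * b"
        by (simp_all only: a_def b_def mult_left_quotient)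
      have "V p (W p (V q (W q (V q (J h))))) = V s (W s (V q (J h)))"
        by (rule nica[OF s]) simp
      also have "W s (V q (J h)) = J (A b h)"
        unfolding ab(2) by (simp add: W_mult W_V W_J)
      also have "V s (J (A b h)) = V p (V a (J (A b h)))"
        unfolding ab(1) by (simp add: V_mult)
      finally show ?thesis
        unfolding flip
        by (simp add: V_ip compression star_kernel_right_ideal[OF s] flip: a_def b_def)
    qed
  qed
  show ?thesis
    unfolding has_star_regular_dilation_def positive_op_matrix_def
  proof (intro allI)
    fix n :: nat and p :: "nat \<Rightarrow> 'p" and h :: "nat \<Rightarrow> 'h"
    have "(\<Sum>i<n. cinner (\<Sum>j<n. star_kernel T (p i) (p j) (h j)) (h i))
        = ip (\<Sum>j<n. V (p j) (J (h j))) (\<Sum>i<n. V (p i) (J (h i)))"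
      by (simp add: cinner.sum_left kernel sum_left sum_right sum_mem)
    also have "\<dots> \<in> \<real>\<^sub>\<ge>\<^sub>0"
      by (intro nonneg sum_mem) auto
    finally show "(\<Sum>i<n. cinner (\<Sum>j<n. star_kernel T (p i) (p j) (h j)) (h i)) \<in> \<real>\<^sub>\<ge>\<^sub>0" .
  qed
qed

section \<open>Completion inside a function space\<close>

text \<open>\<open>\<Phi>\<close> maps a semi-inner product space to functions with continuous point evaluations, and
  every \<open>Q x d\<close> is determined by finitely many values of \<open>\<Phi> x\<close>. Under these
  assumptions the completion consists of the pointwise limits of Cauchy sequences.\<close>

locale function_completion =
  pre: semi_inner_product_on D Q
  for D :: "'d::complex_vector set" and Q +
  fixes \<Phi> :: "'d \<Rightarrow> 'p \<Rightarrow> 'h::chilbert_space"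
  assumes \<Phi>_add: "x \<in> D \<Longrightarrow> y \<in> D \<Longrightarrow> \<Phi> (x + y) = \<Phi> x + \<Phi> y"
    and \<Phi>_scaleC: "x \<in> D \<Longrightarrow> \<Phi> (c *\<^sub>C x) = c *\<^sub>C \<Phi> x"
    and \<Phi>_bound: "x \<in> D \<Longrightarrow> norm (\<Phi> x p) \<le> ipnorm Q x"
    and Q_eval: "d \<in> D \<Longrightarrow> \<exists>C g. \<forall>x\<in>D. Q x d = (\<Sum>p\<in>C. cinner (\<Phi> x p) (g p))"
begin

lemma \<Phi>_diff: "x \<in> D \<Longrightarrow> y \<in> D \<Longrightarrow> \<Phi> (x - y) = \<Phi> x - \<Phi> y"
  using \<Phi>_add[of "x - y" y] by (simp add: algebra_simps)

text \<open>A function is tied to a Cauchy sequence that induces it; by \<open>approx_unique\<close>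
  and \<open>approx_zero\<close>, the function and the Cauchy class determine each other.\<close>

definition approx :: "(nat \<Rightarrow> 'd) \<Rightarrow> ('p \<Rightarrow> 'h) \<Rightarrow> bool"
  where "approx X f \<longleftrightarrow> (\<forall>n. X n \<in> D) \<and>
    (\<forall>e>0. \<exists>N. \<forall>m\<ge>N. \<forall>n\<ge>N. ipnorm Q (X m - X n) < e) \<and> (\<forall>p. (\<lambda>n. \<Phi> (X n) p) \<longlonglongrightarrow> f p)"

lemma approx_mem: "approx X f \<Longrightarrow> X n \<in> D"
  and approx_Cauchy: "approx X f \<Longrightarrow> e > 0 \<Longrightarrow> \<exists>N. \<forall>m\<ge>N. \<forall>n\<ge>N. ipnorm Q (X m - X n) < e"
  and approx_eval: "approx X f \<Longrightarrow> (\<lambda>n. \<Phi> (X n) p) \<longlonglongrightarrow> f p"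
  by (auto simp: approx_def)

lemma approx_unique:
  assumes "approx X f" "approx X g"
  shows "f = g"
  using LIMSEQ_unique[OF approx_eval[OF assms(1)] approx_eval[OF assms(2)]] by blast

lemma approx_const: "d \<in> D \<Longrightarrow> approx (\<lambda>_. d) (\<Phi> d)"
  by (simp add: approx_def)

lemma approx_add:
  assumes X: "approx X f" and Y: "approx Y g"
  shows "approx (\<lambda>n. X n + Y n) (f + g)"
  unfolding approx_def
proof (intro conjI allI impI)
  note mem [simp] = approx_mem[OF X] approx_mem[OF Y]
  show "X n + Y n \<in> D" for n
    by simp
  show "(\<lambda>n. \<Phi> (X n + Y n) p) \<longlonglongrightarrow> (f + g) p" for p
    using tendsto_add[OF approx_eval[OF X] approx_eval[OF Y]] by (simp add: \<Phi>_add)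
  fix e :: real assume "e > 0"
  then have "e / 2 > 0" by simp
  obtain M where M: "\<forall>m\<ge>M. \<forall>n\<ge>M. ipnorm Q (X m - X n) < e / 2"
    using approx_Cauchy[OF X \<open>e / 2 > 0\<close>] by blast
  obtain N where N: "\<forall>m\<ge>N. \<forall>n\<ge>N. ipnorm Q (Y m - Y n) < e / 2"
    using approx_Cauchy[OF Y \<open>e / 2 > 0\<close>] by blast
  have "ipnorm Q (X m + Y m - (X n + Y n)) < e" if "m \<ge> max M N" "n \<ge> max M N" for m n
  proof -
    have "ipnorm Q ((X m - X n) + (Y m - Y n)) \<le> ipnorm Q (X m - X n) + ipnorm Q (Y m - Y n)"
      by (rule pre.ipnorm_triangle) auto
    also have "\<dots> < e / 2 + e / 2"
      using M N that by (intro add_strict_mono) auto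
    finally show ?thesis
      by (simp add: algebra_simps)
  qed
  then show "\<exists>N. \<forall>m\<ge>N. \<forall>n\<ge>N. ipnorm Q (X m + Y m - (X n + Y n)) < e"
    by blast
qed

lemma approx_scaleC:
  assumes X: "approx X f"
  shows "approx (\<lambda>n. c *\<^sub>C X n) (c *\<^sub>C f)"
  unfolding approx_def
proof (intro conjI allI impI)
  note mem [simp] = approx_mem[OF X]
  show "c *\<^sub>C X n \<in> D" for n
    by simp
  have "bounded_linear (\<lambda>x :: 'h. c *\<^sub>C x)"
  proof (rule bounded_linear_intro)
    show "norm (c *\<^sub>C x) \<le> norm x * cmod c" for x :: 'h
      using cinner.ipnorm_scaleC[of x c] by simp
  qed (simp_all add: scaleC_add_right scaleR_scaleC scaleC_scaleC mult.commute)
  from bounded_linear.tendsto[OF this approx_eval[OF X]]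
  show "(\<lambda>n. \<Phi> (c *\<^sub>C X n) p) \<longlonglongrightarrow> (c *\<^sub>C f) p" for p
    by (simp add: \<Phi>_scaleC scaleC_fun_def)
  fix e :: real assume "e > 0"
  then have "e / (cmod c + 1) > 0"
    by (simp add: add_nonneg_pos)
  then obtain N where N: "\<forall>m\<ge>N. \<forall>n\<ge>N. ipnorm Q (X m - X n) < e / (cmod c + 1)"
    using approx_Cauchy[OF X] by blast
  have "ipnorm Q (c *\<^sub>C X m - c *\<^sub>C X n) < e" if "m \<ge> N" "n \<ge> N" for m n
  proof -
    have "ipnorm Q (c *\<^sub>C X m - c *\<^sub>C X n) = cmod c * ipnorm Q (X m - X n)"
      by (simp add: pre.ipnorm_scaleC flip: complex_vector.scale_right_diff_distrib)
    also have "\<dots> \<le> (cmod c + 1) * ipnorm Q (X m - X n)"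
      by (intro mult_right_mono) auto
    also have "\<dots> < e"
      using N that by (simp add: pos_less_divide_eq add_nonneg_pos mult.commute)
    finally show ?thesis .
  qed
  then show "\<exists>N. \<forall>m\<ge>N. \<forall>n\<ge>N. ipnorm Q (c *\<^sub>C X m - c *\<^sub>C X n) < e"
    by blast
qed

lemma approx_diff:
  assumes "approx X f" "approx Y g"
  shows "approx (\<lambda>n. X n - Y n) (f - g)"
proof -
  have "- 1 *\<^sub>C x = - x" for x :: "'a::complex_vector"
    using complex_vector.scale_minus_left[of 1 x] by (simp add: scaleC_one)
  then show ?thesis
    using approx_add[OF assms(1) approx_scaleC[OF assms(2), of "- 1"]] by simp
qed

lemma approx_bounded:
  assumes X: "approx X f"
  obtains B where "B > 0" "\<And>n. ipnorm Q (X n) \<le> B"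
proof -
  note mem [simp] = approx_mem[OF X]
  obtain N where N: "\<forall>m\<ge>N. \<forall>n\<ge>N. ipnorm Q (X m - X n) < 1"
    using approx_Cauchy[OF X, of 1] by auto
  define B where "B = 1 + (\<Sum>n\<le>N. ipnorm Q (X n))"
  have sum_ge: "ipnorm Q (X n) \<le> (\<Sum>n\<le>N. ipnorm Q (X n))" if "n \<le> N" for n
    using that by (intro member_le_sum) auto
  have "ipnorm Q (X n) \<le> B" for n
  proof (cases "n \<le> N")
    case True
    then show ?thesis
      using sum_ge[OF True] by (simp add: B_def)
  next
    case False
    have "ipnorm Q (X n) \<le> ipnorm Q (X n - X N) + ipnorm Q (X N)"
      using pre.ipnorm_triangle[of "X n - X N" "X N"] by simp
    moreover have "ipnorm Q (X n - X N) < 1"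
      using N False by simp
    ultimately show ?thesis
      using sum_ge[of N] by (simp add: B_def)
  qed
  moreover have "B > 0"
    by (auto simp: B_def intro!: add_pos_nonneg sum_nonneg)
  ultimately show ?thesis
    using that by blast
qed

text \<open>Injectivity of the passage to functions. For a late fixed N, the pairing of
  \<open>X n\<close> with \<open>X N\<close> tends to 0 because it depends on finitely many
  evaluations; the rest is small by boundedness and the Cauchy property.\<close>

lemma approx_zero:
  assumes X: "approx X 0"
  shows "(\<lambda>n. ipnorm Q (X n)) \<longlonglongrightarrow> 0"
proof (rule LIMSEQ_I)
  note mem [simp] = approx_mem[OF X]
  fix e :: real assume "e > 0"
  obtain B where B: "B > 0" "\<And>n. ipnorm Q (X n) \<le> B"
    using approx_bounded[OF X] by blast
  have "e\<^sup>2 / (2 * B) > 0"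
    using \<open>e > 0\<close> B(1) by simp
  then obtain N where N: "\<forall>m\<ge>N. \<forall>n\<ge>N. ipnorm Q (X m - X n) < e\<^sup>2 / (2 * B)"
    using approx_Cauchy[OF X] by blast
  obtain C g where Cg: "\<forall>x\<in>D. Q x (X N) = (\<Sum>p\<in>C. cinner (\<Phi> x p) (g p))"
    using Q_eval[of "X N"] by auto
  have "(\<lambda>n. \<Sum>p\<in>C. cinner (\<Phi> (X n) p) (g p)) \<longlonglongrightarrow> (\<Sum>p\<in>C. cinner ((0 :: 'p \<Rightarrow> 'h) p) (g p))"
    by (intro tendsto_sum tendsto_cinner approx_eval[OF X] tendsto_const)
  then have "(\<lambda>n. Q (X n) (X N)) \<longlonglongrightarrow> 0"
    using Cg by simp
  then obtain M where M: "\<And>n. n \<ge> M \<Longrightarrow> cmod (Q (X n) (X N)) < e\<^sup>2 / 2"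
    using LIMSEQ_D[of "\<lambda>n. Q (X n) (X N)" 0 "e\<^sup>2 / 2"] \<open>e > 0\<close> by auto
  have "ipnorm Q (X n) < e" if n: "n \<ge> max M N" for n
  proof (rule power2_less_imp_less)
    have "(ipnorm Q (X n))\<^sup>2 = cmod (Q (X n) (X n))"
      by (simp add: pre.self_eq norm_power)
    also have "\<dots> = cmod (Q (X n) (X N) + Q (X n) (X n - X N))"
      by (simp add: pre.diff_right)
    also have "\<dots> \<le> cmod (Q (X n) (X N)) + cmod (Q (X n) (X n - X N))"
      by (rule norm_triangle_ineq)
    also have "\<dots> < e\<^sup>2 / 2 + e\<^sup>2 / 2"
    proof (rule add_strict_mono)
      have "cmod (Q (X n) (X n - X N)) \<le> ipnorm Q (X n) * ipnorm Q (X n - X N)"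
        by (rule pre.Cauchy_Schwarz) auto
      also have "\<dots> \<le> B * ipnorm Q (X n - X N)"
        by (intro mult_right_mono B) auto
      also have "\<dots> < B * (e\<^sup>2 / (2 * B))"
        using N n B(1) by (intro mult_strict_left_mono) auto
      finally show "cmod (Q (X n) (X n - X N)) < e\<^sup>2 / 2"
        using B(1) by simp
    qed (use M n in auto)
    finally show "(ipnorm Q (X n))\<^sup>2 < e\<^sup>2"
      by simp
  qed (use \<open>e > 0\<close> in auto)
  then show "\<exists>no. \<forall>n\<ge>no. norm (ipnorm Q (X n) - 0) < e"
    by (intro exI[of _ "max M N"]) auto
qed

lemma tendsto_0_Q:
  assumes X: "\<And>n. X n \<in> D" and Y: "\<And>n. Y n \<in> D"
    and lim: "(\<lambda>n. ipnorm Q (X n)) \<longlonglongrightarrow> 0" and B: "\<And>n. ipnorm Q (Y n) \<le> B"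
  shows "(\<lambda>n. Q (X n) (Y n)) \<longlonglongrightarrow> 0" "(\<lambda>n. Q (Y n) (X n)) \<longlonglongrightarrow> 0"
proof -
  have "(\<lambda>n. ipnorm Q (X n) * B) \<longlonglongrightarrow> 0 * B"
    by (intro tendsto_intros lim)
  then have lim': "(\<lambda>n. ipnorm Q (X n) * B) \<longlonglongrightarrow> 0"
    by simp
  have le: "cmod (Q (X n) (Y n)) \<le> ipnorm Q (X n) * B" for n
    using pre.Cauchy_Schwarz[OF X[of n] Y[of n]] mult_left_mono[OF B[of n], of "ipnorm Q (X n)"] X[of n]
    by simp
  moreover have "cmod (Q (Y n) (X n)) = cmod (Q (X n) (Y n))" for n
    using pre.commute[OF X[of n] Y[of n]] by simp
  ultimately show "(\<lambda>n. Q (X n) (Y n)) \<longlonglongrightarrow> 0" "(\<lambda>n. Q (Y n) (X n)) \<longlonglongrightarrow> 0"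
    by (auto intro!: Lim_null_comparison[OF _ lim'])
qed

lemma approx_ip_convergent:
  assumes X: "approx X f" and Y: "approx Y g"
  shows "convergent (\<lambda>n. Q (X n) (Y n))"
proof -
  note mem [simp] = approx_mem[OF X] approx_mem[OF Y]
  obtain B where B: "B > 0" "\<And>n. ipnorm Q (X n) \<le> B"
    using approx_bounded[OF X] by blast
  obtain B' where B': "B' > 0" "\<And>n. ipnorm Q (Y n) \<le> B'"
    using approx_bounded[OF Y] by blast
  have "Cauchy (\<lambda>n. Q (X n) (Y n))"
  proof (rule CauchyI)
    fix e :: real assume "e > 0"
    then have "e / (2 * B') > 0" "e / (2 * B) > 0"
      using B(1) B'(1) by auto
    obtain M where M: "\<forall>m\<ge>M. \<forall>n\<ge>M. ipnorm Q (X m - X n) < e / (2 * B')"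
      using approx_Cauchy[OF X \<open>e / (2 * B') > 0\<close>] by blast
    obtain N where N: "\<forall>m\<ge>N. \<forall>n\<ge>N. ipnorm Q (Y m - Y n) < e / (2 * B)"
      using approx_Cauchy[OF Y \<open>e / (2 * B) > 0\<close>] by blast
    have "norm (Q (X m) (Y m) - Q (X n) (Y n)) < e" if mn: "m \<ge> max M N" "n \<ge> max M N" for m n
    proof -
      have "Q (X m) (Y m) - Q (X n) (Y n) = Q (X m - X n) (Y m) + Q (X n) (Y m - Y n)"
        by (simp add: pre.diff_left pre.diff_right)
      then have "norm (Q (X m) (Y m) - Q (X n) (Y n)) \<le> cmod (Q (X m - X n) (Y m)) + cmod (Q (X n) (Y m - Y n))"
        by (simp only: norm_triangle_ineq)
      also have "\<dots> \<le> ipnorm Q (X m - X n) * B' + B * ipnorm Q (Y m - Y n)"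
        by (intro add_mono order_trans[OF pre.Cauchy_Schwarz] mult_mono B B') (use B(1) in auto)
      also have "\<dots> < e / (2 * B') * B' + B * (e / (2 * B))"
        using M N mn B(1) B'(1)
        by (intro add_strict_mono mult_strict_left_mono mult_strict_right_mono) auto
      also have "\<dots> = e"
        using B(1) B'(1) by simp
      finally show ?thesis .
    qed
    then show "\<exists>M. \<forall>m\<ge>M. \<forall>n\<ge>M. norm (Q (X m) (Y m) - Q (X n) (Y n)) < e"
      by blast
  qed
  then show ?thesis
    by (simp add: Cauchy_convergent_iff)
qed

lemma approx_ip_diff:
  assumes X: "approx X f" and X': "approx X' f" and Y: "approx Y g" and Y': "approx Y' g"
  shows "(\<lambda>n. Q (X n) (Y n) - Q (X' n) (Y' n)) \<longlonglongrightarrow> 0"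
proof -
  note mem [simp] = approx_mem[OF X] approx_mem[OF X'] approx_mem[OF Y] approx_mem[OF Y']
  obtain B where B: "\<And>n. ipnorm Q (X' n) \<le> B"
    using approx_bounded[OF X'] by blast
  obtain B' where B': "\<And>n. ipnorm Q (Y n) \<le> B'"
    using approx_bounded[OF Y] by blast
  have "(\<lambda>n. ipnorm Q (X n - X' n)) \<longlonglongrightarrow> 0" "(\<lambda>n. ipnorm Q (Y n - Y' n)) \<longlonglongrightarrow> 0"
    using approx_zero[of "\<lambda>n. X n - X' n"] approx_zero[of "\<lambda>n. Y n - Y' n"]
      approx_diff[OF X X'] approx_diff[OF Y Y'] by simp_all
  then have "(\<lambda>n. Q (X n - X' n) (Y n) + Q (X' n) (Y n - Y' n)) \<longlonglongrightarrow> 0 + 0"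
    by (intro tendsto_add tendsto_0_Q[OF _ _ _ B'] tendsto_0_Q[OF _ _ _ B]) auto
  then show ?thesis
    by (simp add: pre.diff_left pre.diff_right)
qed

definition completion :: "('p \<Rightarrow> 'h) set"
  where "completion = {f. \<exists>X. approx X f}"

definition approximant :: "('p \<Rightarrow> 'h) \<Rightarrow> nat \<Rightarrow> 'd"
  where "approximant f = (SOME X. approx X f)"

definition lim_ip :: "('p \<Rightarrow> 'h) \<Rightarrow> ('p \<Rightarrow> 'h) \<Rightarrow> complex"
  where "lim_ip f g = lim (\<lambda>n. Q (approximant f n) (approximant g n))"

lemma approx_approximant: "f \<in> completion \<Longrightarrow> approx (approximant f) f"
  using someI_ex[of "\<lambda>X. approx X f"] by (simp add: approximant_def completion_def)

lemma approx_imp_completion: "approx X f \<Longrightarrow> f \<in> completion"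
  by (auto simp: completion_def)

lemma \<Phi>_completion: "d \<in> D \<Longrightarrow> \<Phi> d \<in> completion"
  using approx_const approx_imp_completion by blast

text \<open>The approximants chosen in \<open>lim_ip\<close> are immaterial, since other sequences
  for the same functions differ from them by null sequences.\<close>

lemma lim_ip_LIMSEQ:
  assumes X: "approx X f" and Y: "approx Y g"
  shows "(\<lambda>n. Q (X n) (Y n)) \<longlonglongrightarrow> lim_ip f g"
proof -
  have f: "approx (approximant f) f" and g: "approx (approximant g) g"
    using approx_approximant approx_imp_completion X Y by blast+
  have "(\<lambda>n. Q (approximant f n) (approximant g n)) \<longlonglongrightarrow> lim_ip f g"
    unfolding lim_ip_def using approx_ip_convergent[OF f g] by (simp add: convergent_LIMSEQ_iff)
  from tendsto_add[OF this approx_ip_diff[OF X f Y g]] show ?thesis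
    by simp
qed

lemma lim_ip_eqI:
  assumes "approx X f" "approx Y g" "(\<lambda>n. Q (X n) (Y n)) \<longlonglongrightarrow> l"
  shows "lim_ip f g = l"
  using LIMSEQ_unique[OF lim_ip_LIMSEQ[OF assms(1,2)] assms(3)] .

lemma lim_ip_\<Phi>: "x \<in> D \<Longrightarrow> y \<in> D \<Longrightarrow> lim_ip (\<Phi> x) (\<Phi> y) = Q x y"
  by (rule lim_ip_eqI) (auto intro: approx_const)

lemma ipnorm_LIMSEQ: "approx X f \<Longrightarrow> (\<lambda>n. ipnorm Q (X n)) \<longlonglongrightarrow> ipnorm lim_ip f"
  unfolding ipnorm_def by (intro tendsto_real_sqrt tendsto_Re lim_ip_LIMSEQ)

sublocale compl: semi_inner_product_on completion lim_ip
proof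
  show "csubspace completion"
    unfolding complex_vector.subspace_def
  proof (intro conjI ballI allI)
    show "0 \<in> completion"
      using \<Phi>_completion[of 0] \<Phi>_diff[of 0 0] by simp
    show "f + g \<in> completion" if "f \<in> completion" "g \<in> completion" for f g
      using approx_add[OF approx_approximant[OF that(1)] approx_approximant[OF that(2)]]
      by (rule approx_imp_completion)
    show "c *\<^sub>C f \<in> completion" if "f \<in> completion" for c f
      using approx_scaleC[OF approx_approximant[OF that]] by (rule approx_imp_completion)
  qed
  fix f g k c
  assume f: "f \<in> completion"
  note X = approx_approximant[OF f]
  note X_mem = approx_mem[OF X]
  show "lim_ip f f \<in> \<real>\<^sub>\<ge>\<^sub>0"
    using closed_sequentially[OF closed_nonneg_Reals_complex _ lim_ip_LIMSEQ[OF X X]] pre.nonneg X_mem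
    by blast
  assume g: "g \<in> completion"
  note Y = approx_approximant[OF g]
  note Y_mem = approx_mem[OF Y]
  show "lim_ip f g = cnj (lim_ip g f)"
  proof (rule lim_ip_eqI[OF X Y])
    show "(\<lambda>n. Q (approximant f n) (approximant g n)) \<longlonglongrightarrow> cnj (lim_ip g f)"
      using tendsto_cnj[OF lim_ip_LIMSEQ[OF Y X]] pre.commute[OF X_mem Y_mem] by simp
  qed
  show "lim_ip (c *\<^sub>C f) g = c * lim_ip f g"
  proof (rule lim_ip_eqI[OF approx_scaleC[OF X] Y])
    show "(\<lambda>n. Q (c *\<^sub>C approximant f n) (approximant g n)) \<longlonglongrightarrow> c * lim_ip f g"
      using tendsto_mult_left[OF lim_ip_LIMSEQ[OF X Y], of c] by (simp add: pre.scaleC_left X_mem Y_mem)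
  qed
  assume k: "k \<in> completion"
  note W = approx_approximant[OF k]
  note W_mem = approx_mem[OF W]
  show "lim_ip (f + g) k = lim_ip f k + lim_ip g k"
  proof (rule lim_ip_eqI[OF approx_add[OF X Y] W])
    show "(\<lambda>n. Q (approximant f n + approximant g n) (approximant k n)) \<longlonglongrightarrow> lim_ip f k + lim_ip g k"
      using tendsto_add[OF lim_ip_LIMSEQ[OF X W] lim_ip_LIMSEQ[OF Y W]]
      by (simp add: pre.add_left X_mem Y_mem W_mem)
  qed
qed

lemma ipnorm_\<Phi>: "d \<in> D \<Longrightarrow> ipnorm lim_ip (\<Phi> d) = ipnorm Q d"
  by (simp add: ipnorm_def lim_ip_\<Phi>)

lemma approx_LIMSEQ:
  assumes X: "approx X f"
  shows "(\<lambda>n. ipnorm lim_ip (f - \<Phi> (X n))) \<longlonglongrightarrow> 0"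
proof (rule LIMSEQ_I)
  note mem [simp] = approx_mem[OF X]
  fix e :: real assume "e > 0"
  then obtain N where N: "\<forall>m\<ge>N. \<forall>n\<ge>N. ipnorm Q (X m - X n) < e / 2"
    using approx_Cauchy[OF X, of "e / 2"] by auto
  have "ipnorm lim_ip (f - \<Phi> (X n)) \<le> e / 2" if "n \<ge> N" for n
  proof (rule LIMSEQ_le_const2)
    show "(\<lambda>m. ipnorm Q (X m - X n)) \<longlonglongrightarrow> ipnorm lim_ip (f - \<Phi> (X n))"
      by (rule ipnorm_LIMSEQ[OF approx_diff[OF X approx_const]]) simp
    show "\<exists>M. \<forall>m\<ge>M. ipnorm Q (X m - X n) \<le> e / 2"
      using N that by (intro exI[of _ N]) (auto simp: less_imp_le)
  qed
  moreover have "f - \<Phi> (X n) \<in> completion" for n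
    using approx_imp_completion[OF X] \<Phi>_completion by simp
  ultimately show "\<exists>no. \<forall>n\<ge>no. norm (ipnorm lim_ip (f - \<Phi> (X n)) - 0) < e"
    using \<open>e > 0\<close> by (intro exI[of _ N]) (fastforce simp: field_simps)
qed

text \<open>Definiteness holds because the norm controls point evaluations. For completeness,
  approximate the n-th function within 1/(n+1) by the image of some \<open>d n\<close>; these are
  Cauchy, and their pointwise limit is the limit sought.\<close>

lemma hilbert_space_completion: "hilbert_space_on completion lim_ip"
proof
  show "csubspace completion"
    by (rule compl.csubspace)
  show "f = 0" if f: "f \<in> completion" "lim_ip f f = 0" for f
  proof
    fix p
    note X = approx_approximant[OF f(1)]
    have "(\<lambda>n. ipnorm Q (approximant f n)) \<longlonglongrightarrow> 0"
      using ipnorm_LIMSEQ[OF X] f(2) by (simp add: ipnorm_def[of lim_ip])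
    then have "(\<lambda>n. \<Phi> (approximant f n) p) \<longlonglongrightarrow> 0"
      by (rule tendsto_0_le[where K = 1])
        (use \<Phi>_bound approx_mem[OF X] in \<open>auto intro!: eventuallyI order_trans[OF _ abs_ge_self]\<close>)
    then show "f p = 0 p"
      using LIMSEQ_unique[OF approx_eval[OF X, of p]] by simp
  qed
  fix F :: "nat \<Rightarrow> 'p \<Rightarrow> 'h"
  assume F [simp]: "\<And>n. F n \<in> completion"
    and Cauchy: "\<forall>e>0. \<exists>N. \<forall>m\<ge>N. \<forall>n\<ge>N. ipnorm lim_ip (F m - F n) < e"
  have "\<exists>d\<in>D. ipnorm lim_ip (F n - \<Phi> d) < 1 / real (Suc n)" for n
  proof -
    note X = approx_approximant[OF F[of n]]
    obtain m where "norm (ipnorm lim_ip (F n - \<Phi> (approximant (F n) m)) - 0) < 1 / real (Suc n)"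
      using LIMSEQ_D[OF approx_LIMSEQ[OF X], of "1 / real (Suc n)"] by auto
    then show ?thesis
      using approx_mem[OF X] by (intro bexI[of _ "approximant (F n) m"]) auto
  qed
  then obtain d where d [simp]: "\<And>n. d n \<in> D"
    and close: "\<And>n. ipnorm lim_ip (F n - \<Phi> (d n)) < 1 / real (Suc n)"
    by metis
  note \<Phi>d [simp] = \<Phi>_completion[OF d]
  have inv: "(\<lambda>n. 1 / real (Suc n)) \<longlonglongrightarrow> 0"
    using LIMSEQ_inverse_real_of_nat by (simp add: inverse_eq_divide)
  have d_Cauchy: "\<exists>N. \<forall>m\<ge>N. \<forall>n\<ge>N. ipnorm Q (d m - d n) < e" if "e > 0" for e
  proof -
    have "e / 3 > 0" using that by simp
    obtain M where M: "\<forall>m\<ge>M. \<forall>n\<ge>M. ipnorm lim_ip (F m - F n) < e / 3"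
      using Cauchy \<open>e / 3 > 0\<close> by blast
    obtain N where N: "\<And>n. n \<ge> N \<Longrightarrow> 1 / real (Suc n) < e / 3"
      using LIMSEQ_D[OF inv \<open>e / 3 > 0\<close>] by auto
    have "ipnorm Q (d m - d n) < e" if mn: "m \<ge> max M N" "n \<ge> max M N" for m n
    proof -
      have "ipnorm Q (d m - d n) = ipnorm lim_ip (\<Phi> (d m) - \<Phi> (d n))"
        by (simp add: \<Phi>_diff flip: ipnorm_\<Phi>)
      also have "\<dots> \<le> ipnorm lim_ip (\<Phi> (d m) - F m) + (ipnorm lim_ip (F m - F n) + ipnorm lim_ip (F n - \<Phi> (d n)))"
        by (intro order_trans[OF compl.ipnorm_triangle_diff[where y = "F m"]] add_left_mono
            compl.ipnorm_triangle_diff) auto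
      also have "\<dots> < e / 3 + (e / 3 + e / 3)"
        using M N[of m] N[of n] close[of m] close[of n] mn
        by (intro add_strict_mono) (auto simp: compl.ipnorm_minus_commute[of "\<Phi> (d m)"])
      finally show ?thesis by simp
    qed
    then show ?thesis by blast
  qed
  have "\<exists>x. (\<lambda>n. \<Phi> (d n) p) \<longlonglongrightarrow> x" for p
  proof -
    have "norm (\<Phi> (d m) p - \<Phi> (d n) p) \<le> ipnorm Q (d m - d n)" for m n
      using \<Phi>_bound[of "d m - d n" p] by (simp add: \<Phi>_diff)
    then have "Cauchy (\<lambda>n. \<Phi> (d n) p)"
      by (intro CauchyI) (meson d_Cauchy le_less_trans)
    then show ?thesis
      by (simp add: Cauchy_convergent_iff convergent_def)
  qed
  then obtain f where "\<And>p. (\<lambda>n. \<Phi> (d n) p) \<longlonglongrightarrow> f p"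
    by metis
  then have f: "approx d f"
    using d_Cauchy by (simp add: approx_def)
  note f_mem [simp] = approx_imp_completion[OF f]
  have "(\<lambda>n. ipnorm lim_ip (F n - f)) \<longlonglongrightarrow> 0"
  proof (rule tendsto_sandwich[OF _ _ tendsto_const])
    show "\<forall>\<^sub>F n in sequentially. 0 \<le> ipnorm lim_ip (F n - f)"
      by (intro always_eventually allI compl.ipnorm_nonneg) simp
    have "ipnorm lim_ip (F n - f) \<le> 1 / real (Suc n) + ipnorm lim_ip (f - \<Phi> (d n))" for n
      using compl.ipnorm_triangle_diff[of "F n" "\<Phi> (d n)" f] close[of n]
      by (simp add: compl.ipnorm_minus_commute[of f])
    then show "\<forall>\<^sub>F n in sequentially. ipnorm lim_ip (F n - f) \<le> 1 / real (Suc n) + ipnorm lim_ip (f - \<Phi> (d n))"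
      by (intro always_eventually allI)
    show "(\<lambda>n. 1 / real (Suc n) + ipnorm lim_ip (f - \<Phi> (d n))) \<longlonglongrightarrow> 0"
      using tendsto_add[OF inv approx_LIMSEQ[OF f]] by simp
  qed
  then show "\<exists>f\<in>completion. (\<lambda>n. ipnorm lim_ip (F n - f)) \<longlonglongrightarrow> 0"
    using f_mem by blast
qed (fact compl.commute compl.add_left compl.scaleC_left compl.nonneg)+

end

section \<open>The dilation on the reproducing kernel space\<close>

context contractive_rep
begin

lemma left_quotient_self [simp]: "left_quotient p p = (1::'p)"
  using left_quotient_mult[of p 1] by simp

lemma left_quotient_one [simp]: "left_quotient 1 p = (p::'p)"
  using left_quotient_mult[of 1 p] by simp

lemma scaleC_apply: "(c *\<^sub>C f) x = c *\<^sub>C f x"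
  by (simp add: scaleC_fun_def)

lemma star_kernel_self: "star_kernel T p p h = h"
  using star_kernel_right_ideal[of p p p h] by simp

lemma star_kernel_one_right: "star_kernel T p 1 h = A p h"
  using star_kernel_right_ideal[of p 1 p h] by simp

lemma star_kernel_one_left: "star_kernel T 1 p h = T p h"
  using star_kernel_right_ideal[of 1 p p h] by simp

lemma star_kernel_commute: "cinner (star_kernel T p q h) k = cnj (cinner (star_kernel T q p k) h)"
proof (cases "right_ideal p \<inter> right_ideal q = {}")
  case True
  then show ?thesis
    by (simp add: star_kernel_disjoint Int_commute)
next
  case False
  then obtain s where "right_ideal p \<inter> right_ideal q = right_ideal s"
    using right_lcm[of p q] by blast
  then show ?thesis
    using cinner_star_kernel[of p q s h k] cinner_star_kernel[of q p s k h]
      cinner_commute[of "A (left_quotient q s) h"]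
    by (simp add: Int_commute)
qed

lemma star_kernel_scaleC: "star_kernel T p q (c *\<^sub>C h) = c *\<^sub>C star_kernel T p q h"
proof (cases "right_ideal p \<inter> right_ideal q = {}")
  case False
  then obtain s where "right_ideal p \<inter> right_ideal q = right_ideal s"
    using right_lcm[of p q] by blast
  then show ?thesis
    by (simp add: star_kernel_right_ideal A_scaleC T_scaleC)
qed (simp add: star_kernel_disjoint)

lemma right_ideal_Int_mult:
  fixes r :: 'p
  shows "right_ideal (r * p) \<inter> right_ideal (r * q) = (*) r ` (right_ideal p \<inter> right_ideal q)"
proof -
  have "inj ((*) r)"
    by (auto intro: injI left_cancel)
  then show ?thesis
    by (simp only: image_Int image_right_ideal)
qed

text \<open>Left multiplication by \<open>r\<close> carries common multiples to common multiples and
  leaves the quotients unchanged. This invariance makes the translations isometric.\<close>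

lemma star_kernel_mult_left: "star_kernel T (r * p) (r * q) h = star_kernel T p q h"
proof (cases "right_ideal p \<inter> right_ideal q = {}")
  case True
  then have "right_ideal (r * p) \<inter> right_ideal (r * q) = {}"
    by (simp only: right_ideal_Int_mult image_empty)
  then show ?thesis
    using True by (simp add: star_kernel_disjoint)
next
  case False
  then obtain s where s: "right_ideal p \<inter> right_ideal q = right_ideal s"
    using right_lcm[of p q] by blast
  then have rs: "right_ideal (r * p) \<inter> right_ideal (r * q) = right_ideal (r * s)"
    by (simp only: right_ideal_Int_mult image_right_ideal)
  have "s \<in> right_ideal p" "s \<in> right_ideal q"
    using s right_ideal_refl[of s] by blast+
  then obtain a b where ab: "s = p * a" "s = q * b"
    by blast
  then have "left_quotient p s = a" "left_quotient q s = b"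
    by (metis left_quotient_mult)+
  moreover have "r * s = r * p * a" "r * s = r * q * b"
    using ab by (simp_all add: mult.assoc)
  then have "left_quotient (r * p) (r * s) = a" "left_quotient (r * q) (r * s) = b"
    by (metis left_quotient_mult)+
  ultimately show ?thesis
    by (simp add: star_kernel_right_ideal[OF s] star_kernel_right_ideal[OF rs])
qed

text \<open>At each point only one value of \<open>f\<close> is used, so pointwise limits are
  preserved. On arbitrary functions the result may depend on the generator;
  \<open>completion_mult_unit\<close> excludes this on the dilation space.\<close>

definition dil_V :: "'p \<Rightarrow> ('p \<Rightarrow> 'h) \<Rightarrow> 'p \<Rightarrow> 'h"
  where "dil_V r f q = (if right_ideal r \<inter> right_ideal q = {} then 0
    else let s = generator (right_ideal r \<inter> right_ideal q)
         in T (left_quotient q s) (f (left_quotient r s)))"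

text \<open>This is the kernel function K(.,e)h, since K(q,e) is the adjoint of T(q).\<close>

definition dil_J :: "'h \<Rightarrow> 'p \<Rightarrow> 'h"
  where "dil_J h = (\<lambda>q. A q h)"

lemma dil_J_one: "dil_J h 1 = h"
  by (simp add: dil_J_def)

lemma dil_V_cases:
  obtains (disjoint) "right_ideal r \<inter> right_ideal q = {}" "\<And>f. dil_V r f q = 0"
  | (join) b c where "right_ideal r \<inter> right_ideal q = right_ideal (r * b)" "r * b = q * c"
      "\<And>f. dil_V r f q = T c (f b)"
proof (cases "right_ideal r \<inter> right_ideal q = {}")
  case True
  then show ?thesis
    by (intro disjoint) (simp_all add: dil_V_def)
next
  case False
  define s where "s = generator (right_ideal r \<inter> right_ideal q)"
  have s: "right_ideal r \<inter> right_ideal q = right_ideal s"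
    unfolding s_def
    by (rule right_ideal_generator[OF empty_or_principal_Int, symmetric]) (use False in auto)
  then have "s \<in> right_ideal r" "s \<in> right_ideal q"
    using right_ideal_refl[of s] by blast+
  then have "r * left_quotient r s = s" "q * left_quotient q s = s"
    by (simp_all only: mult_left_quotient)
  moreover have "dil_V r f q = T (left_quotient q s) (f (left_quotient r s))" for f
    using False by (simp add: dil_V_def Let_def s_def)
  ultimately show ?thesis
    using s by (intro join[of "left_quotient r s" "left_quotient q s"]) simp_all
qed

lemma dil_V_dil_J: "dil_V q (dil_J h) p = star_kernel T p q h"
proof (cases rule: dil_V_cases[of q p])
  case disjoint
  then show ?thesis
    by (simp add: star_kernel_disjoint Int_commute)
next
  case (join b c)
  have "right_ideal p \<inter> right_ideal q = right_ideal (q * b)"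
    using join(1) by (simp add: Int_commute)
  then show ?thesis
    using join(2,3) by (simp add: star_kernel_right_ideal dil_J_def) (metis left_quotient_mult)
qed

text \<open>If rP and qP meet in rbP, the common multiples of q and ra are r times those of b and a;
  the outer \<open>T c\<close> completes K(b,a) to K(q,ra).\<close>

lemma dil_V_star_kernel: "dil_V r (\<lambda>p. star_kernel T p a h) q = star_kernel T q (r * a) h"
proof (cases rule: dil_V_cases[of r q])
  case disjoint
  then have "right_ideal q \<inter> right_ideal (r * a) = {}"
    using right_ideal_mult_subset[of r a] by blast
  then show ?thesis
    using disjoint by (simp add: star_kernel_disjoint)
next
  case (join b c)
  have Int_eq: "right_ideal q \<inter> right_ideal (r * a) = (*) r ` (right_ideal b \<inter> right_ideal a)"
  proof -
    have "Q \<inter> Z = R \<inter> Q \<inter> Z" if "Z \<subseteq> R" for Q R Z :: "'p set"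
      using that by blast
    from this[OF right_ideal_mult_subset[of r a], of "right_ideal q"] show ?thesis
      by (simp only: join(1) right_ideal_Int_mult)
  qed
  show ?thesis
  proof (cases "right_ideal b \<inter> right_ideal a = {}")
    case True
    then have "right_ideal q \<inter> right_ideal (r * a) = {}"
      using Int_eq by simp
    then show ?thesis
      using True join(3) by (simp add: star_kernel_disjoint)
  next
    case False
    then obtain t where t: "right_ideal b \<inter> right_ideal a = right_ideal t"
      using right_lcm[of b a] by blast
    then have rt: "right_ideal q \<inter> right_ideal (r * a) = right_ideal (r * t)"
      using Int_eq by (simp only: image_right_ideal)
    have "t \<in> right_ideal b" "t \<in> right_ideal a"
      using t right_ideal_refl[of t] by blast+
    then obtain b' a' where t_eq: "t = b * b'" "t = a * a'"
      by blast
    then have "left_quotient b t = b'" "left_quotient a t = a'"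
      by (metis left_quotient_mult)+
    moreover have "r * t = q * (c * b')" "r * t = (r * a) * a'"
      using t_eq join(2) by (metis mult.assoc)+
    then have "left_quotient q (r * t) = c * b'" "left_quotient (r * a) (r * t) = a'"
      by (metis left_quotient_mult)+
    ultimately show ?thesis
      by (simp add: join(3) star_kernel_right_ideal[OF t] star_kernel_right_ideal[OF rt] T_mult)
  qed
qed

text \<open>\<open>q * u\<close> and \<open>q\<close> have the same multiples, and the quotients
  differ by the left factor \<open>u\<close>. The relation survives pointwise limits.\<close>

lemma star_kernel_mult_unit:
  assumes u: "u * v = 1" "v * u = 1"
  shows "T u (star_kernel T (q * u) a h) = star_kernel T q a h"
proof -
  have qu: "right_ideal (q * u) = right_ideal q"
  proof
    have "q * x = q * u * (v * x)" for x
      using u(1) by (metis mult.assoc mult_1_left)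
    then show "right_ideal q \<subseteq> right_ideal (q * u)"
      by blast
  qed (rule right_ideal_mult_subset)
  show ?thesis
  proof (cases "right_ideal q \<inter> right_ideal a = {}")
    case True
    then show ?thesis
      using qu by (simp add: star_kernel_disjoint)
  next
    case False
    then obtain s where s: "right_ideal q \<inter> right_ideal a = right_ideal s"
      using right_lcm[of q a] by blast
    then have s': "right_ideal (q * u) \<inter> right_ideal a = right_ideal s"
      by (simp only: qu)
    have "s \<in> right_ideal q"
      using s right_ideal_refl[of s] by blast
    then obtain c where c: "s = q * c"
      by blast
    then have "s = q * u * (v * c)"
      using u(1) by (metis mult.assoc mult_1_left)
    then have "left_quotient (q * u) s = v * c"
      by (metis left_quotient_mult)
    moreover have "u * (v * c) = left_quotient q s"
      using u(1) c by (metis left_quotient_mult mult.assoc mult_1_left)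
    ultimately show ?thesis
      by (simp add: star_kernel_right_ideal[OF s] star_kernel_right_ideal[OF s'] flip: T_mult)
  qed
qed

lemma dil_V_add: "dil_V r (f + g) = dil_V r f + dil_V r g"
proof
  show "dil_V r (f + g) q = (dil_V r f + dil_V r g) q" for q
    by (cases rule: dil_V_cases[of r q]) (simp_all add: blinfun.add_right)
qed

lemma dil_V_scaleC: "dil_V r (c *\<^sub>C f) = c *\<^sub>C dil_V r f"
proof
  show "dil_V r (c *\<^sub>C f) q = (c *\<^sub>C dil_V r f) q" for q
    by (cases rule: dil_V_cases[of r q]) (simp_all add: scaleC_fun_def T_scaleC)
qed

section \<open>Formal combinations of kernel functions and their translations\<close>

definition fin_supp :: "('p \<Rightarrow> 'h) set"
  where "fin_supp = {g. finite {p. g p \<noteq> 0}}"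

text \<open>A finitely supported \<open>g\<close> stands for a formal sum of kernel functions
  K(.,q)g(q); this is the function it represents.\<close>

definition kernel_sum :: "('p \<Rightarrow> 'h) \<Rightarrow> 'p \<Rightarrow> 'h"
  where "kernel_sum g p = (\<Sum>q | g q \<noteq> 0. star_kernel T p q (g q))"

definition kernel_form :: "('p \<Rightarrow> 'h) \<Rightarrow> ('p \<Rightarrow> 'h) \<Rightarrow> complex"
  where "kernel_form g g' = (\<Sum>p | g' p \<noteq> 0. cinner (kernel_sum g p) (g' p))"

lemma kernel_sum_eq:
  assumes "finite C" "{q. g q \<noteq> 0} \<subseteq> C"
  shows "kernel_sum g p = (\<Sum>q\<in>C. star_kernel T p q (g q))"
  unfolding kernel_sum_def using assms by (intro sum.mono_neutral_left) auto

lemma kernel_form_eq: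
  assumes "finite C" "{q. g' q \<noteq> 0} \<subseteq> C"
  shows "kernel_form g g' = (\<Sum>p\<in>C. cinner (kernel_sum g p) (g' p))"
  unfolding kernel_form_def using assms by (intro sum.mono_neutral_left) auto

lemma kernel_form_eq2:
  assumes "finite C" "{q. g q \<noteq> 0} \<subseteq> C" "{q. g' q \<noteq> 0} \<subseteq> C"
  shows "kernel_form g g' = (\<Sum>p\<in>C. \<Sum>q\<in>C. cinner (star_kernel T p q (g q)) (g' p))"
  using assms by (simp add: kernel_form_eq[of C] kernel_sum_eq[of C g] cinner.sum_left)

lemma kernel_sum_add:
  assumes "g \<in> fin_supp" "g' \<in> fin_supp"
  shows "kernel_sum (g + g') = kernel_sum g + kernel_sum g'"
proof
  fix p
  define C where "C = {q. g q \<noteq> 0} \<union> {q. g' q \<noteq> 0}"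
  have "finite C" "{q. g q \<noteq> 0} \<subseteq> C" "{q. g' q \<noteq> 0} \<subseteq> C" "{q. (g + g') q \<noteq> 0} \<subseteq> C"
    using assms by (auto simp: C_def fin_supp_def)
  then show "kernel_sum (g + g') p = (kernel_sum g + kernel_sum g') p"
    using kernel_sum_eq[of C g p] kernel_sum_eq[of C g' p] kernel_sum_eq[of C "g + g'" p]
    by (simp add: blinfun.add_right sum.distrib)
qed

lemma kernel_sum_scaleC:
  assumes "g \<in> fin_supp"
  shows "kernel_sum (c *\<^sub>C g) = c *\<^sub>C kernel_sum g"
proof
  fix p
  define C where "C = {q. g q \<noteq> 0}"
  have "finite C" "{q. g q \<noteq> 0} \<subseteq> C" "{q. (c *\<^sub>C g) q \<noteq> 0} \<subseteq> C"
    using assms by (auto simp: C_def fin_supp_def scaleC_fun_def)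
  then show "kernel_sum (c *\<^sub>C g) p = (c *\<^sub>C kernel_sum g) p"
    using kernel_sum_eq[of C g p] kernel_sum_eq[of C "c *\<^sub>C g" p]
    by (simp add: star_kernel_scaleC scaleC_fun_def complex_vector.scale_sum_right)
qed

lemma csubspace_fin_supp: "csubspace fin_supp"
  unfolding complex_vector.subspace_def
proof (intro conjI ballI allI)
  show "0 \<in> fin_supp"
    by (simp add: fin_supp_def)
  show "f + g \<in> fin_supp" if "f \<in> fin_supp" "g \<in> fin_supp" for f g
    unfolding fin_supp_def mem_Collect_eq
    by (rule finite_subset[of _ "{p. f p \<noteq> 0} \<union> {p. g p \<noteq> 0}"]) (use that in \<open>auto simp: fin_supp_def\<close>)
  show "c *\<^sub>C f \<in> fin_supp" if "f \<in> fin_supp" for c f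
    unfolding fin_supp_def mem_Collect_eq
    by (rule finite_subset[of _ "{p. f p \<noteq> 0}"]) (use that in \<open>auto simp: fin_supp_def scaleC_fun_def\<close>)
qed

definition delta :: "'p \<Rightarrow> 'h \<Rightarrow> 'p \<Rightarrow> 'h"
  where "delta p h = (\<lambda>q. if q = p then h else 0)"

lemma delta_fin_supp [simp]: "delta p h \<in> fin_supp"
  by (simp add: delta_def fin_supp_def)

lemma kernel_sum_delta: "kernel_sum (delta q h) p = star_kernel T p q h"
  by (subst kernel_sum_eq[of "{q}"]) (auto simp: delta_def)

lemma kernel_form_delta: "kernel_form g (delta p h) = cinner (kernel_sum g p) h"
  by (subst kernel_form_eq[of "{p}"]) (auto simp: delta_def)

lemma kernel_sum_delta_eq_dil: "kernel_sum (delta q h) = dil_V q (dil_J h)"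
  by (simp add: fun_eq_iff kernel_sum_delta dil_V_dil_J)

text \<open>The algebraic model of V(r): it moves the coefficient at q to rq, without collisions by
  left cancellation.\<close>

definition push :: "'p \<Rightarrow> ('p \<Rightarrow> 'h) \<Rightarrow> 'p \<Rightarrow> 'h"
  where "push r g q = (if q \<in> right_ideal r then g (left_quotient r q) else 0)"

lemma push_mult [simp]: "push r g (r * q) = g q"
  by (simp add: push_def)

lemma push_eq_0: "q \<notin> right_ideal r \<Longrightarrow> push r g q = 0"
  by (auto simp: push_def)

lemma push_one: "push 1 g = g"
  by (simp add: fun_eq_iff push_def)

lemma push_push: "push (p * q) g = push p (push q g)"
proof
  fix x
  show "push (p * q) g x = push p (push q g) x"
  proof (cases "x \<in> right_ideal (p * q)")
    case True
    then obtain a where x: "x = p * (q * a)"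
      by (auto simp: mult.assoc)
    then show ?thesis
      using push_mult[of "p * q" g a] by (simp add: mult.assoc)
  next
    case False
    then have "push p (push q g) x = 0"
      by (auto simp: push_def mult.assoc)
    then show ?thesis
      using False by (simp add: push_eq_0)
  qed
qed

lemma push_diff: "push r (g - g') = push r g - push r g'"
  by (simp add: fun_eq_iff push_def)

lemma supp_push: "{q. push r g q \<noteq> 0} = (*) r ` {q. g q \<noteq> 0}"
  by (auto simp: push_def dest: left_cancel)

lemma push_fin_supp: "g \<in> fin_supp \<Longrightarrow> push r g \<in> fin_supp"
  by (simp add: fin_supp_def supp_push)

lemma sum_push_reindex: "(\<Sum>q\<in>(*) r ` C. F q (push r g q)) = (\<Sum>q\<in>C. F (r * q) (g q))"
proof -
  have "inj_on ((*) r) C"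
    by (auto intro: inj_onI left_cancel)
  then show ?thesis
    by (simp add: sum.reindex)
qed

lemma dil_V_sum: "dil_V r (\<lambda>p. \<Sum>i\<in>I. f i p) q = (\<Sum>i\<in>I. dil_V r (f i) q)"
  by (cases rule: dil_V_cases[of r q]) (simp_all add: blinfun.sum_right)

lemma kernel_sum_push:
  assumes "g \<in> fin_supp"
  shows "kernel_sum (push r g) = dil_V r (kernel_sum g)"
proof
  fix q
  define C where "C = {q. g q \<noteq> 0}"
  have C: "finite C"
    using assms by (simp add: C_def fin_supp_def)
  have "kernel_sum (push r g) q = (\<Sum>a\<in>(*) r ` C. star_kernel T q a (push r g a))"
    using C by (intro kernel_sum_eq) (simp_all add: C_def supp_push)
  also have "\<dots> = (\<Sum>a\<in>C. star_kernel T q (r * a) (g a))"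
    by (rule sum_push_reindex)
  also have "\<dots> = dil_V r (kernel_sum g) q"
    unfolding kernel_sum_def dil_V_sum dil_V_star_kernel C_def ..
  finally show "kernel_sum (push r g) q = dil_V r (kernel_sum g) q" .
qed

lemma kernel_form_push:
  assumes "g \<in> fin_supp" "g' \<in> fin_supp"
  shows "kernel_form (push r g) (push r g') = kernel_form g g'"
proof -
  define C where "C = {q. g q \<noteq> 0} \<union> {q. g' q \<noteq> 0}"
  have C: "finite C" "{q. g q \<noteq> 0} \<subseteq> C" "{q. g' q \<noteq> 0} \<subseteq> C"
    using assms by (auto simp: C_def fin_supp_def)
  have "kernel_form (push r g) (push r g')
      = (\<Sum>p\<in>(*) r ` C. \<Sum>q\<in>(*) r ` C. cinner (star_kernel T p q (push r g q)) (push r g' p))"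
    using C by (intro kernel_form_eq2) (auto simp: supp_push)
  also have "\<dots> = (\<Sum>p\<in>C. \<Sum>q\<in>(*) r ` C. cinner (star_kernel T (r * p) q (push r g q)) (g' p))"
    by (rule sum_push_reindex)
  also have "\<dots> = (\<Sum>p\<in>C. \<Sum>q\<in>C. cinner (star_kernel T (r * p) (r * q) (g q)) (g' p))"
    by (intro sum.cong refl sum_push_reindex)
  also have "\<dots> = (\<Sum>p\<in>C. \<Sum>q\<in>C. cinner (star_kernel T p q (g q)) (g' p))"
    by (simp only: star_kernel_mult_left)
  also have "\<dots> = kernel_form g g'"
    using C by (simp add: kernel_form_eq2)
  finally show ?thesis .
qed

lemma kernel_form_eval: "\<exists>C g. \<forall>x\<in>fin_supp. kernel_form x d = (\<Sum>p\<in>C. cinner (kernel_sum x p) (g p))"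
  unfolding kernel_form_def by blast

end

section \<open>The dilation space and its isometries for a positive definite kernel\<close>

locale star_regular_rep = contractive_rep +
  assumes star_regular: "has_star_regular_dilation T"
begin

sublocale kernel: semi_inner_product_on fin_supp kernel_form
proof
  show "csubspace fin_supp"
    by (rule csubspace_fin_supp)
  fix f g k c
  assume f: "f \<in> fin_supp"
  have "kernel_form f f = (\<Sum>p | f p \<noteq> 0. \<Sum>q | f q \<noteq> 0. cinner (star_kernel T p q (f q)) (f p))"
    using f by (intro kernel_form_eq2) (auto simp: fin_supp_def)
  also have "\<dots> \<in> \<real>\<^sub>\<ge>\<^sub>0"
    by (rule star_regular_imp_finite_psd[OF star_regular]) (use f in \<open>simp add: fin_supp_def\<close>)
  finally show "kernel_form f f \<in> \<real>\<^sub>\<ge>\<^sub>0" .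
  show "kernel_form (c *\<^sub>C f) g = c * kernel_form f g"
    using f by (simp add: kernel_form_def kernel_sum_scaleC scaleC_apply cinner_scaleC_left sum_distrib_left)
  assume g: "g \<in> fin_supp"
  define C where "C = {q. f q \<noteq> 0} \<union> {q. g q \<noteq> 0}"
  have C: "finite C" "{q. f q \<noteq> 0} \<subseteq> C" "{q. g q \<noteq> 0} \<subseteq> C"
    using f g by (auto simp: C_def fin_supp_def)
  have "kernel_form f g = (\<Sum>p\<in>C. \<Sum>q\<in>C. cinner (star_kernel T p q (f q)) (g p))"
    using C by (intro kernel_form_eq2)
  also have "\<dots> = (\<Sum>q\<in>C. \<Sum>p\<in>C. cnj (cinner (star_kernel T q p (g p)) (f q)))"
    by (subst sum.swap) (intro sum.cong refl star_kernel_commute)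
  also have "\<dots> = cnj (kernel_form g f)"
    using C by (simp add: kernel_form_eq2)
  finally show "kernel_form f g = cnj (kernel_form g f)" .
  show "kernel_form (f + g) k = kernel_form f k + kernel_form g k"
    using f g by (simp add: kernel_form_def kernel_sum_add cinner_add_left sum.distrib)
qed

text \<open>Cauchy-Schwarz against \<open>delta p k\<close> with \<open>k\<close> the value itself;
  its norm is that of \<open>k\<close> because K(p,p) = 1.\<close>

lemma norm_kernel_sum_le:
  assumes g: "g \<in> fin_supp"
  shows "norm (kernel_sum g p) \<le> ipnorm kernel_form g"
proof -
  define k where "k = kernel_sum g p"
  have "ipnorm kernel_form (delta p k) = norm k"
    by (simp add: ipnorm_def kernel_form_delta kernel_sum_delta star_kernel_self cinner_self)
  moreover have "kernel_form g (delta p k) = complex_of_real ((norm k)\<^sup>2)"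
    by (simp add: kernel_form_delta cinner_self flip: k_def)
  ultimately have "norm k * norm k \<le> ipnorm kernel_form g * norm k"
    using kernel.Cauchy_Schwarz[OF g delta_fin_supp[of p k]] by (simp add: power2_eq_square norm_mult)
  then show ?thesis
    using g by (cases "norm k = 0") (auto simp: k_def)
qed

sublocale rkhs: function_completion fin_supp kernel_form kernel_sum
  by unfold_locales
    (simp_all add: kernel_sum_add kernel_sum_scaleC norm_kernel_sum_le kernel_form_eval)

sublocale dil: hilbert_space_on rkhs.completion rkhs.lim_ip
  by (rule rkhs.hilbert_space_completion)

text \<open>This reduces identities for \<open>dil_V\<close> on the completion to identities for
  \<open>push\<close> on formal sums.\<close>

lemma approx_push:
  assumes X: "rkhs.approx X f"
  shows "rkhs.approx (\<lambda>n. push r (X n)) (dil_V r f)"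
  unfolding rkhs.approx_def
proof (intro conjI allI impI)
  note mem [simp] = rkhs.approx_mem[OF X]
  show "push r (X n) \<in> fin_supp" for n
    by (simp add: push_fin_supp)
  have "ipnorm kernel_form (push r (X m) - push r (X n)) = ipnorm kernel_form (X m - X n)" for m n
    by (simp add: ipnorm_def kernel_form_push flip: push_diff)
  then show "\<exists>N. \<forall>m\<ge>N. \<forall>n\<ge>N. ipnorm kernel_form (push r (X m) - push r (X n)) < e" if "e > 0" for e
    using rkhs.approx_Cauchy[OF X that] by simp
  show "(\<lambda>n. kernel_sum (push r (X n)) q) \<longlonglongrightarrow> dil_V r f q" for q
    by (cases rule: dil_V_cases[of r q])
      (auto simp: kernel_sum_push intro!: blinfun.tendsto tendsto_const rkhs.approx_eval[OF X])
qed

lemma dil_V_mem: "f \<in> rkhs.completion \<Longrightarrow> dil_V r f \<in> rkhs.completion"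
  using approx_push rkhs.approx_approximant rkhs.approx_imp_completion by blast

text \<open>The defining formula may use a generator \<open>q * u\<close> with \<open>u\<close>
  invertible. Working with approximants and \<open>approx_unique\<close> avoids it, here and in
  \<open>dil_V_mult\<close>.\<close>

lemma dil_V_one:
  assumes "f \<in> rkhs.completion"
  shows "dil_V 1 f = f"
proof (rule rkhs.approx_unique)
  note X = rkhs.approx_approximant[OF assms]
  show "rkhs.approx (rkhs.approximant f) f"
    by (rule X)
  show "rkhs.approx (rkhs.approximant f) (dil_V 1 f)"
    using approx_push[OF X, of 1] by (simp add: push_one)
qed

lemma dil_V_mult:
  assumes "f \<in> rkhs.completion"
  shows "dil_V (p * q) f = dil_V p (dil_V q f)"
proof (rule rkhs.approx_unique)
  note X = rkhs.approx_approximant[OF assms]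
  show "rkhs.approx (\<lambda>n. push (p * q) (rkhs.approximant f n)) (dil_V (p * q) f)"
    by (rule approx_push[OF X])
  show "rkhs.approx (\<lambda>n. push (p * q) (rkhs.approximant f n)) (dil_V p (dil_V q f))"
    using approx_push[OF approx_push[OF X]] by (simp add: push_push)
qed

lemma dil_V_isometric:
  assumes "f \<in> rkhs.completion"
  shows "ipnorm rkhs.lim_ip (dil_V p f) = ipnorm rkhs.lim_ip f"
proof -
  note X = rkhs.approx_approximant[OF assms]
  have "rkhs.lim_ip (dil_V p f) (dil_V p f) = rkhs.lim_ip f f"
    using rkhs.lim_ip_LIMSEQ[OF X X]
    by (intro rkhs.lim_ip_eqI[OF approx_push[OF X] approx_push[OF X]])
      (simp add: kernel_form_push rkhs.approx_mem[OF X])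
  then show ?thesis
    by (simp add: ipnorm_def)
qed

lemma clinear_on_dil_V: "clinear_on rkhs.completion (dil_V p)"
  by (simp add: clinear_on_def dil_V_mem dil_V_add dil_V_scaleC)

lemma dil_J_eq_kernel_sum: "dil_J h = kernel_sum (delta 1 h)"
  by (simp add: fun_eq_iff kernel_sum_delta star_kernel_one_right dil_J_def)

lemma dil_J_mem: "dil_J h \<in> rkhs.completion"
  unfolding dil_J_eq_kernel_sum by (rule rkhs.\<Phi>_completion) simp

lemma reproducing:
  assumes "f \<in> rkhs.completion"
  shows "rkhs.lim_ip f (dil_V p (dil_J h)) = cinner (f p) h"
proof (rule rkhs.lim_ip_eqI)
  note X = rkhs.approx_approximant[OF assms]
  show "rkhs.approx (rkhs.approximant f) f"
    by (rule X)
  show "rkhs.approx (\<lambda>_. delta p h) (dil_V p (dil_J h))"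
    using rkhs.approx_const[OF delta_fin_supp] by (simp add: kernel_sum_delta_eq_dil)
  show "(\<lambda>n. kernel_form (rkhs.approximant f n) (delta p h)) \<longlonglongrightarrow> cinner (f p) h"
    unfolding kernel_form_delta by (intro tendsto_cinner rkhs.approx_eval[OF X] tendsto_const)
qed

lemma reproducing_one:
  "f \<in> rkhs.completion \<Longrightarrow> rkhs.lim_ip f (dil_J h) = cinner (f 1) h"
  using reproducing[of f 1 h] by (simp add: dil_V_one dil_J_mem)

lemma completion_mult_unit:
  assumes f: "f \<in> rkhs.completion" and u: "u * v = 1" "v * u = 1"
  shows "T u (f (q * u)) = f q"
proof (rule LIMSEQ_unique)
  note X = rkhs.approx_approximant[OF f]
  show "(\<lambda>n. kernel_sum (rkhs.approximant f n) q) \<longlonglongrightarrow> f q"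
    by (rule rkhs.approx_eval[OF X])
  have "T u (kernel_sum g (q * u)) = kernel_sum g q" for g
    by (simp add: kernel_sum_def blinfun.sum_right star_kernel_mult_unit[OF u])
  then show "(\<lambda>n. kernel_sum (rkhs.approximant f n) q) \<longlonglongrightarrow> T u (f (q * u))"
    using blinfun.tendsto[OF tendsto_const rkhs.approx_eval[OF X, of "q * u"], of "T u"] by simp
qed

text \<open>Pair with V(a) applied to \<open>dil_J k\<close>: since V(r)V(a) = V(ra), the
  reproducing property reads off the value at \<open>r * a\<close>.\<close>

lemma adjoint_dil_V:
  assumes f: "f \<in> rkhs.completion"
  shows "adjoint_on rkhs.completion rkhs.lim_ip (dil_V r) f = (\<lambda>a. f (r * a))"
proof
  fix a
  define W where "W = adjoint_on rkhs.completion rkhs.lim_ip (dil_V r)"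
  have bound: "ipnorm rkhs.lim_ip (dil_V r g) \<le> 1 * ipnorm rkhs.lim_ip g" if "g \<in> rkhs.completion" for g
    using dil_V_isometric[OF that] by simp
  have W_mem: "W f \<in> rkhs.completion"
    unfolding W_def by (rule dil.adjoint_on_mem[OF clinear_on_dil_V bound f])
  have W_ip: "rkhs.lim_ip (dil_V r g) f = rkhs.lim_ip g (W f)" if "g \<in> rkhs.completion" for g
    unfolding W_def by (rule dil.adjoint_on_ip[OF clinear_on_dil_V bound that f])
  show "W f a = f (r * a)"
  proof (rule cinner_eqI_left)
    fix k
    have mem: "dil_V p (dil_J k) \<in> rkhs.completion" for p
      by (simp add: dil_V_mem dil_J_mem)
    have "cinner (W f a) k = rkhs.lim_ip (W f) (dil_V a (dil_J k))"
      by (simp add: reproducing W_mem)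
    also have "\<dots> = cnj (rkhs.lim_ip (dil_V a (dil_J k)) (W f))"
      by (rule rkhs.compl.commute[OF W_mem mem])
    also have "\<dots> = cnj (rkhs.lim_ip (dil_V (r * a) (dil_J k)) f)"
      by (simp add: dil_V_mult dil_J_mem flip: W_ip[OF mem])
    also have "\<dots> = rkhs.lim_ip f (dil_V (r * a) (dil_J k))"
      by (rule rkhs.compl.commute[OF f mem, symmetric])
    also have "\<dots> = cinner (f (r * a)) k"
      by (rule reproducing[OF f])
    finally show "cinner (W f a) k = cinner (f (r * a)) k" .
  qed
qed

section \<open>Range projections and Nica covariance\<close>

definition range_proj :: "'a \<Rightarrow> ('a \<Rightarrow> 'b) \<Rightarrow> 'a \<Rightarrow> 'b"
  where "range_proj r = dil_V r \<circ> adjoint_on rkhs.completion rkhs.lim_ip (dil_V r)"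

lemma range_proj_mem:
  assumes "f \<in> rkhs.completion"
  shows "range_proj r f \<in> rkhs.completion"
proof -
  have "adjoint_on rkhs.completion rkhs.lim_ip (dil_V r) f \<in> rkhs.completion"
    by (rule dil.adjoint_on_mem[OF clinear_on_dil_V _ assms, where C = 1]) (simp add: dil_V_isometric)
  then show ?thesis
    by (simp add: range_proj_def dil_V_mem)
qed

lemma range_proj_disjoint:
  assumes "f \<in> rkhs.completion" "right_ideal r \<inter> right_ideal q = {}"
  shows "range_proj r f q = 0"
  using assms by (simp add: range_proj_def dil_V_def)

text \<open>The generator used by \<open>dil_V\<close> may be \<open>q * c * u\<close>; the unit is
  absorbed by \<open>completion_mult_unit\<close>. So only the intersection ideal matters, not
  \<open>r\<close> itself.\<close>

lemma range_proj_right_ideal: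
  assumes f: "f \<in> rkhs.completion" and t: "right_ideal r \<inter> right_ideal q = right_ideal (q * c)"
  shows "range_proj r f q = T c (f (q * c))"
proof (cases rule: dil_V_cases[of r q])
  case disjoint
  then show ?thesis
    using t by simp
next
  case (join b c')
  have "right_ideal (q * c) = right_ideal (q * c')"
    using t join(1,2) by simp
  then obtain u v where u: "q * c' = q * c * u" "u * v = 1" "v * u = 1"
    by (rule right_ideal_eq_imp_unit)
  have "c' = c * u"
    using u(1) by (metis left_cancel mult.assoc)
  then show ?thesis
    using completion_mult_unit[OF f u(2,3), of "q * c"]
    by (simp add: range_proj_def adjoint_dil_V[OF f] join(2,3) T_mult mult.assoc)
qed

text \<open>At \<open>a\<close>, the projection of \<open>p\<close> moves the evaluation to a
  generator of the intersection of pP and aP, and that of \<open>q\<close> moves it on into qP. The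
  projection of \<open>r\<close> does this in one step.\<close>

lemma range_proj_mult:
  assumes pq: "right_ideal p \<inter> right_ideal q = right_ideal r" and f: "f \<in> rkhs.completion"
  shows "range_proj p (range_proj q f) = range_proj r f"
proof
  fix a
  note qf = range_proj_mem[OF f, of q]
  show "range_proj p (range_proj q f) a = range_proj r f a"
  proof (cases "right_ideal p \<inter> right_ideal a = {}")
    case True
    then have "right_ideal r \<inter> right_ideal a = {}"
      using pq by blast
    then show ?thesis
      using True f qf by (simp add: range_proj_disjoint)
  next
    case False
    then obtain s where s: "right_ideal p \<inter> right_ideal a = right_ideal s"
      using right_lcm[of p a] by blast
    then have "s \<in> right_ideal a"
      using right_ideal_refl[of s] by blast
    then obtain c where c: "s = a * c"
      by blast
    have E: "range_proj p (range_proj q f) a = T c (range_proj q f (a * c))"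
      using range_proj_right_ideal[OF qf] s c by simp
    have qs: "right_ideal q \<inter> right_ideal (a * c) = right_ideal r \<inter> right_ideal a"
      using pq s c by blast
    show ?thesis
    proof (cases "right_ideal r \<inter> right_ideal a = {}")
      case True
      then show ?thesis
        unfolding E using f qs by (simp add: range_proj_disjoint)
    next
      case False
      then obtain t where t: "right_ideal r \<inter> right_ideal a = right_ideal t"
        using right_lcm[of r a] by blast
      then have "t \<in> right_ideal (a * c)"
        using qs right_ideal_refl[of t] by blast
      then obtain d where d: "t = a * c * d"
        by blast
      have "range_proj q f (a * c) = T d (f (a * c * d))"
        by (rule range_proj_right_ideal[OF f]) (use qs t d in simp)
      moreover have "range_proj r f a = T (c * d) (f (a * (c * d)))"
        by (rule range_proj_right_ideal[OF f]) (use t d in \<open>simp add: mult.assoc\<close>)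
      ultimately show ?thesis
        unfolding E by (simp add: T_mult mult.assoc)
    qed
  qed
qed

lemma range_proj_orthogonal:
  assumes pq: "right_ideal p \<inter> right_ideal q = {}" and f: "f \<in> rkhs.completion"
  shows "range_proj p (range_proj q f) = 0"
proof
  fix a
  note qf = range_proj_mem[OF f, of q]
  show "range_proj p (range_proj q f) a = 0 a"
  proof (cases "right_ideal p \<inter> right_ideal a = {}")
    case False
    then obtain s where s: "right_ideal p \<inter> right_ideal a = right_ideal s"
      using right_lcm[of p a] by blast
    then have "s \<in> right_ideal a"
      using right_ideal_refl[of s] by blast
    then obtain c where c: "s = a * c"
      by blast
    have "right_ideal q \<inter> right_ideal (a * c) = {}"
      using pq s c by blast
    then show ?thesis
      using range_proj_right_ideal[OF qf, of p a c] s c f by (simp add: range_proj_disjoint)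
  qed (use qf in \<open>simp add: range_proj_disjoint\<close>)
qed

lemma minimal_isometric_nica_dilation:
  "minimal_isometric_nica_dilation T rkhs.completion rkhs.lim_ip dil_J dil_V"
  unfolding minimal_isometric_nica_dilation_def
proof (intro conjI allI ballI impI)
  show "hilbert_space_on rkhs.completion rkhs.lim_ip"
    by (rule rkhs.hilbert_space_completion)
  show "clinear dil_J"
    unfolding Vector_Spaces.linear_iff
    by (auto intro: complex_vector.vector_space_axioms simp: dil_J_def fun_eq_iff blinfun.add_right A_scaleC scaleC_fun_def)
  show "range dil_J \<subseteq> rkhs.completion"
    using dil_J_mem by blast
  show "rkhs.lim_ip (dil_J h) (dil_J k) = cinner h k" for h k
    by (simp add: reproducing_one dil_J_mem dil_J_one)
  show "isometric_rep_on rkhs.completion rkhs.lim_ip dil_V"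
    by (simp add: isometric_rep_on_def clinear_on_dil_V dil_V_isometric dil_V_one dil_V_mult)
  \<comment> \<open>Pairing with \<open>dil_J\<close> sees only the value at the identity, and there
    both functions equal \<open>T p h\<close>.\<close>
  show "is_orth_proj rkhs.lim_ip (range dil_J) (dil_V p (dil_J h)) (dil_J (T p h))" for p h
    by (auto simp: is_orth_proj_def reproducing_one dil_V_mem dil_J_mem)
      (simp add: dil_V_dil_J star_kernel_one_left dil_J_one)
  show "\<exists>y\<in>cspan {dil_V p (dil_J h) | p h. True}. ipnorm rkhs.lim_ip (f - y) < e"
    if f: "f \<in> rkhs.completion" and "e > 0" for f e
  proof -
    note X = rkhs.approx_approximant[OF f]
    obtain n where n: "ipnorm rkhs.lim_ip (f - kernel_sum (rkhs.approximant f n)) < e"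
      using LIMSEQ_D[OF rkhs.approx_LIMSEQ[OF X] \<open>e > 0\<close>] by (auto simp: abs_less_iff)
    have sum_eq: "kernel_sum g = (\<Sum>q | g q \<noteq> 0. dil_V q (dil_J (g q)))" for g
    proof
      have "(\<Sum>q\<in>C. dil_V q (dil_J (g q))) p = (\<Sum>q\<in>C. dil_V q (dil_J (g q)) p)" for C p
        by (induction C rule: infinite_finite_induct) auto
      then show "kernel_sum g p = (\<Sum>q | g q \<noteq> 0. dil_V q (dil_J (g q))) p" for p
        by (simp add: kernel_sum_def dil_V_dil_J)
    qed
    have "kernel_sum (rkhs.approximant f n) \<in> cspan {dil_V p (dil_J h) | p h. True}"
      unfolding sum_eq by (intro complex_vector.span_sum complex_vector.span_base) blast
    then show ?thesis
      using n by blast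
  qed
  show "nica_covariant_on rkhs.completion rkhs.lim_ip dil_V"
    by (auto simp: nica_covariant_on_def range_proj_mult range_proj_orthogonal simp flip: range_proj_def)
qed

end

text \<open>Dilation spaces are sought inside one type. The last conjunct shows that nothing is
  lost: a dilation in any type \<open>'k\<close> yields one on functions from the semigroup to the
  original space.\<close>

theorem theorem4p11:
  fixes T :: "'p::right_lcm_semigroup \<Rightarrow> ('h::chilbert_space \<Rightarrow>\<^sub>L 'h)"
    and P0 :: "'p set"
  assumes "descending_chain_condition TYPE('p)"
    and "minimal_set P0"
    and "unital_contractive_rep T"
  shows "(has_star_regular_dilation T \<longleftrightarrow> has_minimal_isometric_nica_dilation TYPE('p \<Rightarrow> 'h) T) \<and>
    (has_star_regular_dilation T \<longleftrightarrow> (\<forall>F. finite F \<and> F \<subseteq> P0 \<longrightarrow> positive_op (Z T F))) \<and>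
    (has_minimal_isometric_nica_dilation TYPE('k::complex_vector) T \<longrightarrow>
      has_minimal_isometric_nica_dilation TYPE('p \<Rightarrow> 'h) T)"
proof -
  interpret contractive_rep T
    using assms(3) by unfold_locales
  have dilation: "has_minimal_isometric_nica_dilation TYPE('p \<Rightarrow> 'h) T" if "has_star_regular_dilation T"
  proof -
    interpret star_regular_rep T
      using that by unfold_locales
    show ?thesis
      unfolding has_minimal_isometric_nica_dilation_def using minimal_isometric_nica_dilation by blast
  qed
  have "has_star_regular_dilation T" if "has_minimal_isometric_nica_dilation TYPE('p \<Rightarrow> 'h) T"
    using that dilation_imp_star_regular unfolding has_minimal_isometric_nica_dilation_def by blast
  moreover have "has_star_regular_dilation T" if "has_minimal_isometric_nica_dilation TYPE('k) T"
    using that dilation_imp_star_regular unfolding has_minimal_isometric_nica_dilation_def by blast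
  moreover have "has_star_regular_dilation T" if "\<forall>F. finite F \<and> F \<subseteq> P0 \<longrightarrow> positive_op (Z T F)"
    using that zeta_nonneg_of_minimal_set[OF assms(1,2)]
    by (intro zeta_nonneg_imp_star_regular) (simp add: positive_op_Z_iff)
  moreover have "positive_op (Z T F)" if "has_star_regular_dilation T" "finite F" for F
    using star_regular_imp_zeta_nonneg[OF that] that(2) by (simp add: positive_op_Z_iff)
  ultimately show ?thesis
    using dilation by blast
qed

end
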